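(* Let $(\mathcal Q,d)$ be a metric space, $\mathcal Y$ a (measurable) set, and $\mathfrak c\colon \mathcal Y\times\mathcal Q\to\mathbb R$ a function. Let $Y$ be a random variable with values in $\mathcal Y$, let $Y_1,Y_2,\dots$ be independent random variables with the same distribution as $Y$, and let $(\epsilon_n)_{n\in\mathbb N}\subseteq[0,\infty)$ with $\epsilon_n\to 0$ as $n\to\infty$. Set $$M=\operatorname*{arg\,min}_{q\in\mathcal Q}\mathbb E[\mathfrak c(Y,q)],\qquad M_n=\epsilon_n\text{-}\operatorname*{arg\,min}_{q\in\mathcal Q}\frac1n\sum_{i=1}^n\mathfrak c(Y_i,q).$$ Assume: (1) $(\mathcal Q,d)$ is separable and complete; (2) for every $y\in\mathcal Y$, the function $q\mapsto\mathfrak c(y,q)$ is lower semi-continuous; (3) $\mathbb E[\inf_{q\in\mathcal Q}\mathfrak c(Y,q)]>-\infty$; (4) almost surely the following is true: there is $N_0\in\mathbb N$ such that every closed and bounded subset (closed in $\mathcal Q$) of $\bigcup_{n\ge N_0}M_n$ is compact; (5) $\mathbb E[\sup_{q\in B}|\mathfrak c(Y,q)|]<\infty$ for all bounded sets $B\subseteq\mathcal Q$; (6) there are $o\in\mathcal Q$, functions $\psi^+,\psi^-\colon[0,\infty)\to[0,\infty)$, constants $\mathfrak a^+,\mathfrak a^-\in(0,\infty)$, and, for each $n$, $\sigma(Y_1,\dots,Y_n)$-measurable random variables $\mathfrak a^+_n,\mathfrak a^-_n\in[0,\infty)$ such that $$\mathfrak a^+\psi^+(d(q,o))-\mathfrak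 a^-\psi^-(d(q,o))\le\mathbb E[\mathfrak c(Y,q)],$$ $$\mathfrak a_n^+\psi^+(d(q,o))-\mathfrak a_n^-\psi^-(d(q,o))\le\frac1n\sum_{i=1}^n\mathfrak c(Y_i,q)$$ for all $q\in\mathcal Q$; furthermore $\mathfrak a_n^+\to\mathfrak a^+$ and $\mathfrak a_n^-\to\mathfrak a^-$ almost surely as $n\to\infty$; and $\psi^+(\delta)/\max(1,\psi^-(\delta))\to\infty$ as $\delta\to\infty$. Then $$d_\subseteq(M_n,M)\to0\quad\text{almost surely as } n\to\infty.$$
   Context: All random variables are defined on a common probability space $(\Omega,\Sigma,\mathbb P)$. For $f\colon\mathcal Q\to\mathbb R$ and $\epsilon\ge0$: $\operatorname{arg\,min} f=\{q\in\mathcal Q: f(q)=\inf_{\mathcal Q} f\}$ and $\epsilon\text{-}\operatorname{arg\,min} f=\{q\in\mathcal Q: f(q)\le\epsilon+\inf_{\mathcal Q} f\}$ (empty if $\inf_{\mathcal Q} f=-\infty$). The one-sided Hausdorff distance between $B,B'\subseteq\mathcal Q$ is $d_\subseteq(B,B'):=\sup_{x\in B}\inf_{x'\in B'}d(x,x')\in[0,\infty]$, with $\sup\emptyset=0$ and $\inf\emptyset=\infty$. $f$ is lower semi-continuous if $\liminf_{x\to x_0}f(x)\ge f(x_0)$ for all $x_0\in\mathcal Q$. Measurability convention: all spaces carry the necessary measurable structure and all functions are measurable whenever necessary. In particular, $\mathcal Y$ carries a $\sigma$-algebra, $\mathcal Q$ its Borel $\sigma$-algebra, $\mathfrak c$ is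 jointly measurable, and expectations and almost sure statements are understood with respect to the completion of the probability space. *)

theory Defs
  imports "HOL-Probability.Probability"
begin

text \<open>
  The infima below are taken in \<^typ>\<open>ereal\<close>, because \<^const>\<open>Inf\<close> on the reals is unspecified for
  sets that are not bounded below. If the infimum is \<open>-\<infinity>\<close>, both sets are empty.
\<close>

definition argmin_set :: "('q \<Rightarrow> real) \<Rightarrow> 'q set" where
  "argmin_set f = {q. ereal (f q) = (INF q'. ereal (f q'))}"

definition eps_argmin_set :: "real \<Rightarrow> ('q \<Rightarrow> real) \<Rightarrow> 'q set" where
  "eps_argmin_set \<epsilon> f = {q. ereal (f q) \<le> ereal \<epsilon> + (INF q'. ereal (f q'))}"

text \<open>In \<^typ>\<open>ennreal\<close> the conventions \<open>sup {} = 0\<close> and \<open>inf {} = \<infinity>\<close> hold automatically.\<close>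

definition one_sided_hausdorff :: "'q::metric_space set \<Rightarrow> 'q set \<Rightarrow> ennreal" where
  "one_sided_hausdorff B B' = (SUP x\<in>B. INF x'\<in>B'. ennreal (dist x x'))"

text \<open>At an isolated point the filter \<^term>\<open>at x0\<close> is trivial and the limes inferior is \<open>\<infinity>\<close>.\<close>

definition lower_semicontinuous :: "('q::topological_space \<Rightarrow> real) \<Rightarrow> bool" where
  "lower_semicontinuous f \<longleftrightarrow> (\<forall>x0. ereal (f x0) \<le> Liminf (at x0) (\<lambda>x. ereal (f x)))"

text \<open>
  The expectation, with respect to the completion, of an extended real random variable at least
  one of whose positive and negative parts is integrable. If neither is, the value is that of
  \<open>\<infinity> - \<infinity>\<close> in \<^typ>\<open>ereal\<close>, namely \<open>\<infinity>\<close>, and has no meaning.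
  The completion matters: for jointly measurable \<open>c\<close> and a Polish parameter space, the function
  \<open>\<omega> \<mapsto> inf\<^sub>q c (Y \<omega>) q\<close> is measurable with respect to the completion (measurable
  projection), but in general not with respect to \<open>P\<close> itself.
\<close>

definition ereal_expectation :: "'w measure \<Rightarrow> ('w \<Rightarrow> ereal) \<Rightarrow> ereal" where
  "ereal_expectation P f =
     enn2ereal (\<integral>\<^sup>+\<omega>. e2ennreal (f \<omega>) \<partial>completion P) -
     enn2ereal (\<integral>\<^sup>+\<omega>. e2ennreal (- f \<omega>) \<partial>completion P)"

definition generated_sigma :: "'w measure \<Rightarrow> 'y measure \<Rightarrow> (nat \<Rightarrow> 'w \<Rightarrow> 'y) \<Rightarrow> nat \<Rightarrow> 'w measure" where
  "generated_sigma P S Ys n =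
     sigma (space P) (\<Union>i\<in>{1..n}. {Ys i -` A \<inter> space P |A. A \<in> sets S})"

definition mean_cost :: "'w measure \<Rightarrow> ('y \<Rightarrow> 'q \<Rightarrow> real) \<Rightarrow> ('w \<Rightarrow> 'y) \<Rightarrow> 'q \<Rightarrow> real" where
  "mean_cost P c Y q = (\<integral>\<omega>. c (Y \<omega>) q \<partial>P)"

definition empirical_cost ::
    "('y \<Rightarrow> 'q \<Rightarrow> real) \<Rightarrow> (nat \<Rightarrow> 'w \<Rightarrow> 'y) \<Rightarrow> nat \<Rightarrow> 'w \<Rightarrow> 'q \<Rightarrow> real" where
  "empirical_cost c Ys n \<omega> q = 1 / real n * (\<Sum>i=1..n. c (Ys i \<omega>) q)"

end

theory Submission
  imports Defs
begin

text \<open>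
  Write \<open>F\<close> for the mean cost and \<open>F n\<close> for the empirical cost of the first \<open>n\<close> observations. The theorem follows
  from three properties that hold almost surely.

  First, every \<open>q\<close> has neighbourhoods on which \<open>F n\<close> is eventually not
  much smaller than \<open>F q\<close>, and the exceptional null set does not depend on
  \<open>q\<close> (\<open>AE_empirical_cost_lower\<close>). For a small ball \<open>U\<close>
  around \<open>q\<close>, the empirical cost on \<open>U\<close> is at least the empirical average
  of \<open>inf\<^sub>U c (Y i)\<close>; by the strong law of large numbers this average tends to
  its mean, and by lower semi-continuity and dominated convergence the mean tends to \<open>F
  q\<close> as \<open>U\<close> shrinks. By separability, countably many balls suffice. Second, by
  the strong law at countably many points, \<open>F n p < a\<close> eventually for some
  \<open>p\<close>, whenever \<open>a\<close> exceeds the infimum of \<open>F\<close>. Third, the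
  lower bound in terms of \<open>\<psi>p\<close> and \<open>\<psi>m\<close> confines the approximate
  minimizers of \<open>F n\<close> to a fixed ball for large \<open>n\<close>
  (\<open>eps_argmin_set_eventually_bounded\<close>).

  The rest is deterministic (\<open>one_sided_hausdorff_eps_argmin_tendsto\<close>): a sequence of approximate minimizers
  is bounded, hence has a convergent subsequence by the compactness hypothesis, and the first two properties
  force the limit to minimize \<open>F\<close>.

  Two general results carry the probabilistic part. The infimum of a jointly measurable function over a
  ball of parameters is measurable for the completed law of \<open>Y\<close>; this is the measurable projection theorem
  (\<open>measurable_projection\<close>), proved with Suslin schemes and a capacity argument. It cannot be replaced by an
  infimum over a dense sequence, since a lower semi-continuous function may dip at a single point. The
  strong law of large numbers for integrable variables (\<open>strong_law_of_large_numbers_iid\<close>) comes from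
  Garsia's maximal ergodic argument.
\<close>

section \<open>Suslin schemes and measurable projection\<close>

text \<open>
  Continuity for the product topology on \<open>nat \<Rightarrow> nat\<close> and the discrete topology on the codomain. The
  number of coordinates that decide the value may depend on the point; this is what makes the class
  closed under countable unions, where the first coordinate selects a member of the union.
\<close>

definition locally_constant :: "((nat \<Rightarrow> nat) \<Rightarrow> 'a) \<Rightarrow> bool" where
  "locally_constant f \<longleftrightarrow> (\<forall>x. \<exists>k. \<forall>y. (\<forall>i<k. y i = x i) \<longrightarrow> f y = f x)"

lemma locally_constant_reindex:
  assumes "locally_constant f"
  shows "locally_constant (\<lambda>x. f (\<lambda>j. x (p j)))"
  unfolding locally_constant_def
proof
  fix x :: "nat \<Rightarrow> nat"
  obtain k where k: "\<And>y. (\<forall>i<k. y i = x (p i)) \<Longrightarrow> f y = f (\<lambda>j. x (p j))"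
    using assms unfolding locally_constant_def by meson
  define l where "l = Suc (Max (insert 0 (p ` {..<k})))"
  have "p i < l" if "i < k" for i
    using that unfolding l_def by (auto intro!: le_imp_less_Suc Max_ge)
  then show "\<exists>l. \<forall>y. (\<forall>i<l. y i = x i) \<longrightarrow> f (\<lambda>j. y (p j)) = f (\<lambda>j. x (p j))"
    by (intro exI[of _ l] allI impI k) auto
qed

lemma locally_constant_branch:
  assumes "\<And>n. locally_constant (f n)"
  shows "locally_constant (\<lambda>x. f (x 0) (\<lambda>j. x (Suc j)))"
  unfolding locally_constant_def
proof
  fix x :: "nat \<Rightarrow> nat"
  obtain k where k: "\<And>y. (\<forall>i<k. y i = x (Suc i)) \<Longrightarrow> f (x 0) y = f (x 0) (\<lambda>j. x (Suc j))"
    using assms[of "x 0"] unfolding locally_constant_def by meson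
  show "\<exists>l. \<forall>y. (\<forall>i<l. y i = x i) \<longrightarrow> f (y 0) (\<lambda>j. y (Suc j)) = f (x 0) (\<lambda>j. x (Suc j))"
  proof (intro exI[of _ "Suc k"] allI impI)
    fix y assume y: "\<forall>i<Suc k. y i = x i"
    then have "y 0 = x 0" by auto
    then show "f (y 0) (\<lambda>j. y (Suc j)) = f (x 0) (\<lambda>j. x (Suc j))"
      using k[of "\<lambda>j. y (Suc j)"] y by auto
  qed
qed

lemma dense_sequence:
  obtains d :: "nat \<Rightarrow> 'q::second_countable_topology"
  where "\<And>U. open U \<Longrightarrow> U \<noteq> {} \<Longrightarrow> \<exists>n. d n \<in> U"
proof -
  obtain D :: "'q set" where D: "countable D" "\<And>U. \<lbrakk>open U; U \<noteq> {}\<rbrakk> \<Longrightarrow> \<exists>d\<in>D. d \<in> U"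
    using countable_dense_exists by blast
  then have "D \<noteq> {}" using open_UNIV by blast
  then obtain d :: "nat \<Rightarrow> 'q" where "D = range d"
    using D(1) uncountable_def by blast
  then show ?thesis using D(2) by (intro that[of d]) blast
qed

text \<open>
  A Suslin scheme is a countable list of constraints \<open>w \<in> fst (R m x) \<and> q \<in> snd (R m x)\<close> that depend on
  a code \<open>x\<close>; its kernel consists of the points \<open>(w, q)\<close> for which some code satisfies all of them.
  The usual operation, which intersects along the finite prefixes of \<open>x\<close>, is the case where \<open>R m x\<close>
  depends on the first \<open>m\<close> coordinates; locally constant constraints give the same kernels and let codes
  be merged and split by reindexing. The last clause makes the code determine \<open>q\<close>: in a complete space,
  the closed sets of a code have a common point as soon as any finitely many of them do.
\<close>

definition suslin_scheme ::
    "'w measure \<Rightarrow> (nat \<Rightarrow> (nat \<Rightarrow> nat) \<Rightarrow> 'w set \<times> 'q::metric_space set) \<Rightarrow> bool" where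
  "suslin_scheme M R \<longleftrightarrow>
     (\<forall>m x. fst (R m x) \<in> sets M \<and> closed (snd (R m x))) \<and>
     (\<forall>m. locally_constant (R m)) \<and>
     (\<forall>x e. e > 0 \<longrightarrow> (\<exists>m. \<forall>p\<in>snd (R m x). \<forall>q\<in>snd (R m x). dist p q < e))"

definition suslin_kernel ::
    "(nat \<Rightarrow> (nat \<Rightarrow> nat) \<Rightarrow> 'w set \<times> 'q set) \<Rightarrow> ('w \<times> 'q) set" where
  "suslin_kernel R = {(w, q). \<exists>x. \<forall>m. w \<in> fst (R m x) \<and> q \<in> snd (R m x)}"

definition suslin_sets :: "'w measure \<Rightarrow> ('w \<times> 'q::metric_space) set set" where
  "suslin_sets M = {suslin_kernel R | R. suslin_scheme M R}"

text \<open>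
  The code of a point \<open>q\<close> lists, for every \<open>m\<close>, the index of a point of a dense sequence within
  \<open>1 / (m + 1)\<close> of \<open>q\<close>.
\<close>

lemma suslin_sets_Times_closed:
  fixes F :: "'q::polish_space set"
  assumes "E \<in> sets M" "closed F"
  shows "E \<times> F \<in> suslin_sets M"
proof -
  obtain d :: "nat \<Rightarrow> 'q" where d: "\<And>U. open U \<Longrightarrow> U \<noteq> {} \<Longrightarrow> \<exists>n. d n \<in> U"
    using dense_sequence by blast
  define R where "R m x = (E, F \<inter> cball (d (x m)) (inverse (real (Suc m))))" for m and x :: "nat \<Rightarrow> nat"
  have "suslin_scheme M R"
    unfolding suslin_scheme_def
  proof (intro conjI allI impI)
    fix m show "locally_constant (R m)"
      unfolding locally_constant_def R_def by (auto intro!: exI[of _ "Suc m"])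
  next
    fix x :: "nat \<Rightarrow> nat" and e :: real assume "e > 0"
    then obtain m where m: "inverse (real (Suc m)) < e / 2"
      using reals_Archimedean[of "e/2"] by auto
    have "dist p q < e" if "p \<in> snd (R m x)" "q \<in> snd (R m x)" for p q
    proof -
      have "dist (d (x m)) p \<le> inverse (real (Suc m))" "dist (d (x m)) q \<le> inverse (real (Suc m))"
        using that by (auto simp: R_def)
      then show ?thesis using m dist_triangle3[of p q "d (x m)"] by linarith
    qed
    then show "\<exists>m. \<forall>p\<in>snd (R m x). \<forall>q\<in>snd (R m x). dist p q < e" by blast
  qed (use assms in \<open>auto simp: R_def\<close>)
  moreover have "suslin_kernel R = E \<times> F"
  proof -
    have "\<exists>x. \<forall>m. q \<in> cball (d (x m)) (inverse (real (Suc m)))" for q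
    proof -
      have "\<exists>n. q \<in> cball (d n) (inverse (real (Suc m)))" for m
        using d[of "ball q (inverse (real (Suc m)))"]
        by (auto simp: dist_commute intro: less_imp_le)
      then show ?thesis by metis
    qed
    then show ?thesis unfolding suslin_kernel_def R_def by auto
  qed
  ultimately show ?thesis unfolding suslin_sets_def by blast
qed

text \<open>A code for a point of the union is the index of a member followed by a code for that member.\<close>

lemma suslin_sets_UN:
  assumes "\<And>n::nat. A n \<in> suslin_sets M"
  shows "(\<Union>n. A n) \<in> suslin_sets M"
proof -
  obtain R where R: "\<And>n. suslin_scheme M (R n)" "\<And>n. A n = suslin_kernel (R n)"
    using assms unfolding suslin_sets_def mem_Collect_eq by metis
  define R' where "R' m x = R (x 0) m (\<lambda>j. x (Suc j))" for m and x :: "nat \<Rightarrow> nat"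
  have "suslin_scheme M R'"
    using R(1) locally_constant_branch[of "\<lambda>n. R n m" for m]
    unfolding suslin_scheme_def R'_def by auto
  moreover have "suslin_kernel R' = (\<Union>n. A n)"
  proof -
    have *: "(\<exists>x. P (x 0) (\<lambda>j. x (Suc j))) \<longleftrightarrow> (\<exists>n x. P n x)" for P :: "nat \<Rightarrow> (nat \<Rightarrow> nat) \<Rightarrow> bool"
    proof
      assume "\<exists>n x. P n x"
      then obtain n x where "P n x" by blast
      then show "\<exists>x. P (x 0) (\<lambda>j. x (Suc j))" by (intro exI[of _ "case_nat n x"]) simp
    qed blast
    show ?thesis
      unfolding R(2) suslin_kernel_def R'_def
      by (subst *[of "\<lambda>n x. \<forall>m. _ \<in> fst (R n m x) \<and> _ \<in> snd (R n m x)"]) auto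
  qed
  ultimately show ?thesis unfolding suslin_sets_def by blast
qed

text \<open>
  A code for a point of the intersection interleaves codes for all members, along the pairing function;
  the constraints of all members are enumerated in the same way.
\<close>

lemma suslin_sets_INT:
  assumes "\<And>n::nat. A n \<in> suslin_sets M"
  shows "(\<Inter>n. A n) \<in> suslin_sets M"
proof -
  obtain R where R: "\<And>n. suslin_scheme M (R n)" "\<And>n. A n = suslin_kernel (R n)"
    using assms unfolding suslin_sets_def mem_Collect_eq by metis
  define R' where "R' k x = (case prod_decode k of (n, m) \<Rightarrow> R n m (\<lambda>j. x (prod_encode (n, j))))"
    for k and x :: "nat \<Rightarrow> nat"
  have R'_encode: "R' (prod_encode (n, m)) x = R n m (\<lambda>j. x (prod_encode (n, j)))" for n m x
    by (simp add: R'_def)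
  have all_iff: "(\<forall>k. P k) \<longleftrightarrow> (\<forall>n m. P (prod_encode (n, m)))" for P
    by (metis prod_decode_inverse surj_pair)
  have "suslin_scheme M R'"
    unfolding suslin_scheme_def
  proof (intro conjI)
    show "\<forall>m x. fst (R' m x) \<in> sets M \<and> closed (snd (R' m x))"
      unfolding R'_def using R(1) by (auto simp: suslin_scheme_def split: prod.split)
    show "\<forall>m. locally_constant (R' m)"
    proof
      fix k
      obtain n m where k: "prod_decode k = (n, m)" by (cases "prod_decode k")
      have "R' k = (\<lambda>x. R n m (\<lambda>j. x (prod_encode (n, j))))" by (simp add: R'_def k fun_eq_iff)
      moreover have "locally_constant (R n m)" using R(1) by (simp add: suslin_scheme_def)
      ultimately show "locally_constant (R' k)"
        using locally_constant_reindex[of "R n m" "\<lambda>j. prod_encode (n, j)"] by simp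
    qed
    show "\<forall>x e. e > 0 \<longrightarrow> (\<exists>m. \<forall>p\<in>snd (R' m x). \<forall>q\<in>snd (R' m x). dist p q < e)"
    proof (intro allI impI)
      fix x :: "nat \<Rightarrow> nat" and e :: real assume "e > 0"
      then obtain m where "\<forall>p\<in>snd (R 0 m (\<lambda>j. x (prod_encode (0, j)))). 
          \<forall>q\<in>snd (R 0 m (\<lambda>j. x (prod_encode (0, j)))). dist p q < e"
        using R(1)[of 0] unfolding suslin_scheme_def by meson
      then show "\<exists>m. \<forall>p\<in>snd (R' m x). \<forall>q\<in>snd (R' m x). dist p q < e"
        by (intro exI[of _ "prod_encode (0, m)"]) (simp add: R'_encode)
    qed
  qed
  moreover have "suslin_kernel R' = (\<Inter>n. A n)"
  proof -
    have *: "(\<exists>x. \<forall>n. P n (\<lambda>j. x (prod_encode (n, j)))) \<longleftrightarrow> (\<forall>n. \<exists>x. P n x)"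
      for P :: "nat \<Rightarrow> (nat \<Rightarrow> nat) \<Rightarrow> bool"
    proof
      assume "\<forall>n. \<exists>x. P n x"
      then obtain X where "\<And>n. P n (X n)" by metis
      then show "\<exists>x. \<forall>n. P n (\<lambda>j. x (prod_encode (n, j)))"
        by (intro exI[of _ "\<lambda>k. case prod_decode k of (n, j) \<Rightarrow> X n j"]) simp
    qed blast
    have R'_all: "(\<forall>k. w \<in> fst (R' k x) \<and> q \<in> snd (R' k x)) \<longleftrightarrow> (\<forall>n m.
        w \<in> fst (R n m (\<lambda>j. x (prod_encode (n, j)))) \<and> q \<in> snd (R n m (\<lambda>j. x (prod_encode (n, j)))))" for w q x
      by (subst all_iff) (simp add: R'_encode)
    have "(\<exists>x. \<forall>k. w \<in> fst (R' k x) \<and> q \<in> snd (R' k x)) \<longleftrightarrow>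
        (\<forall>n. \<exists>x. \<forall>m. w \<in> fst (R n m x) \<and> q \<in> snd (R n m x))" for w q
      unfolding R'_all by (rule *)
    then show ?thesis
      unfolding R(2) suslin_kernel_def by auto
  qed
  ultimately show ?thesis unfolding suslin_sets_def by blast
qed

lemma suslin_sets_Un:
  assumes "A \<in> suslin_sets M" "B \<in> suslin_sets M"
  shows "A \<union> B \<in> suslin_sets M"
proof -
  have "(\<Union>n. case_nat A (\<lambda>_. B) n) = A \<union> B"
    by (auto split: nat.splits intro: exI[of _ 0] exI[of _ "Suc 0"])
  moreover have "(\<Union>n. case_nat A (\<lambda>_. B) n) \<in> suslin_sets M"
    using assms by (intro suslin_sets_UN) (auto split: nat.split)
  ultimately show ?thesis by simp
qed

lemma suslin_sets_Int:
  assumes "A \<in> suslin_sets M" "B \<in> suslin_sets M"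
  shows "A \<inter> B \<in> suslin_sets M"
proof -
  have "(\<Inter>n. case_nat A (\<lambda>_. B) n) = A \<inter> B"
    by (auto split: nat.splits)
  moreover have "(\<Inter>n. case_nat A (\<lambda>_. B) n) \<in> suslin_sets M"
    using assms by (intro suslin_sets_INT) (auto split: nat.split)
  ultimately show ?thesis by simp
qed

lemma open_eq_UN_closed:
  fixes U :: "'a::metric_space set"
  assumes "open U"
  obtains C :: "nat \<Rightarrow> 'a set" where "\<And>n. closed (C n)" "(\<Union>n. C n) = U"
proof (cases "U = UNIV")
  case True
  then show ?thesis using that[of "\<lambda>_. UNIV"] by simp
next
  case False
  have inside: "x \<in> U \<longleftrightarrow> 0 < infdist x (- U)" for x
    using in_closed_iff_infdist_zero[of "- U" x] False assms infdist_nonneg[of x "- U"]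
    by (auto simp: less_le closed_Compl)
  have "closed {x. inverse (real (Suc n)) \<le> infdist x (- U)}" for n
    by (intro closed_Collect_le continuous_intros)
  moreover have "(\<Union>n. {x. inverse (real (Suc n)) \<le> infdist x (- U)}) = U"
  proof (intro set_eqI iffI)
    fix x assume "x \<in> U"
    then obtain n where "inverse (real (Suc n)) < infdist x (- U)"
      using reals_Archimedean inside by blast
    then show "x \<in> (\<Union>n. {x. inverse (real (Suc n)) \<le> infdist x (- U)})"
      by (auto intro: less_imp_le)
  next
    fix x assume "x \<in> (\<Union>n. {x. inverse (real (Suc n)) \<le> infdist x (- U)})"
    then obtain n where "inverse (real (Suc n)) \<le> infdist x (- U)" by blast
    moreover have "0 < inverse (real (Suc n))" by simp
    ultimately show "x \<in> U" unfolding inside by linarith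
  qed
  ultimately show ?thesis by (rule that)
qed

text \<open>
  Suslin sets are in general not closed under complements. The sets that are Suslin together with
  their complement do form a \<open>\<sigma>\<close>-algebra, and it contains the measurable rectangles because an open
  set of a metric space is a countable union of closed ones.
\<close>

lemma pair_borel_in_suslin_sets:
  fixes A :: "('w \<times> 'q::polish_space) set"
  assumes "A \<in> sets (M \<Otimes>\<^sub>M borel)"
  shows "A \<in> suslin_sets M"
proof -
  define bi where "bi = {A :: ('w \<times> 'q) set. A \<subseteq> space M \<times> UNIV \<and> A \<in> suslin_sets M
    \<and> space M \<times> UNIV - A \<in> suslin_sets M}"
  have bi_Compl: "space M \<times> UNIV - A \<in> bi" if "A \<in> bi" for A
    using that unfolding bi_def by (auto simp: double_diff)
  have bi_UN: "(\<Union>n::nat. A n) \<in> bi" if "\<And>n. A n \<in> bi" for A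
  proof -
    have "space M \<times> UNIV - (\<Union>n. A n) = (\<Inter>n. space M \<times> UNIV - A n)" by auto
    also have "\<dots> \<in> suslin_sets M"
      using that by (intro suslin_sets_INT) (auto simp: bi_def)
    finally show ?thesis
      using that unfolding bi_def by (auto intro!: suslin_sets_UN simp: subset_eq)
  qed
  have bi_empty: "{} \<in> bi"
    using suslin_sets_Times_closed[of "{}" M "UNIV :: 'q set"]
      suslin_sets_Times_closed[of "space M" M "UNIV :: 'q set"] by (auto simp: bi_def)
  have strip: "space M \<times> B \<in> bi" if "B \<in> sets borel" for B :: "'q set"
  proof -
    have "B \<in> sigma_sets UNIV {F. closed F}"
      using that by (simp add: borel_eq_closed)
    then show ?thesis
    proof induction
      case (Basic F)
      then have "closed F" by simp
      obtain C where C: "\<And>n::nat. closed (C n)" "(\<Union>n. C n) = - F"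
        using open_eq_UN_closed[of "- F"] \<open>closed F\<close> by auto
      have "space M \<times> UNIV - space M \<times> F = (\<Union>n. space M \<times> C n)"
        using C(2) by auto
      also have "\<dots> \<in> suslin_sets M"
        using C(1) by (intro suslin_sets_UN suslin_sets_Times_closed) auto
      finally show ?case
        unfolding bi_def using suslin_sets_Times_closed[OF sets.top \<open>closed F\<close>] by auto
    next
      case Empty
      then show ?case using bi_empty by simp
    next
      case (Compl B)
      have "space M \<times> (UNIV - B) = space M \<times> UNIV - space M \<times> B" by auto
      then show ?case using bi_Compl[OF Compl.IH] by simp
    next
      case (Union B)
      have "space M \<times> (\<Union>n. B n) = (\<Union>n. space M \<times> B n)" by auto
      then show ?case using bi_UN[OF Union.IH] by simp
    qed
  qed
  have "A \<in> sigma_sets (space M \<times> UNIV) {E \<times> B | E B. E \<in> sets M \<and> B \<in> sets (borel :: 'q measure)}"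
    using assms by (simp add: sets_pair_measure)
  then have "A \<in> bi"
  proof induction
    case (Basic A)
    then obtain E B where A: "A = E \<times> B" and E: "E \<in> sets M" and B: "B \<in> sets (borel :: 'q measure)"
      by blast
    have "A = E \<times> UNIV \<inter> space M \<times> B"
      using sets.sets_into_space[OF E] A by auto
    moreover have "E \<times> UNIV \<inter> space M \<times> B \<in> suslin_sets M"
      using strip[OF B] E suslin_sets_Times_closed[OF E closed_UNIV]
      by (intro suslin_sets_Int) (auto simp: bi_def)
    moreover have "space M \<times> UNIV - A = (space M - E) \<times> UNIV \<union> (space M \<times> UNIV - space M \<times> B)"
      using sets.sets_into_space[OF E] A by auto
    moreover have "(space M - E) \<times> UNIV \<union> (space M \<times> UNIV - space M \<times> B) \<in> suslin_sets M"
      using strip[OF B] suslin_sets_Times_closed[OF sets.compl_sets[OF E] closed_UNIV]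
      by (intro suslin_sets_Un) (auto simp: bi_def)
    ultimately show ?case
      unfolding bi_def using sets.sets_into_space[OF E] A by auto
  next
    case (Compl A)
    then show ?case using bi_Compl by blast
  next
    case (Union A)
    then show ?case using bi_UN by blast
  qed (rule bi_empty)
  then show ?thesis by (simp add: bi_def)
qed

lemma compact_nat_box:
  fixes N :: "nat \<Rightarrow> nat"
  shows "compact {x. \<forall>i. x i \<le> N i}"
proof -
  have "compactin (product_topology (\<lambda>_. euclidean) UNIV) (PiE UNIV (\<lambda>i. {..N i}))"
    by (subst compactin_PiE) (auto simp: finite_imp_compact)
  moreover have "PiE UNIV (\<lambda>i. {..N i}) = {x. \<forall>i. x i \<le> N i}"
    by auto
  ultimately show ?thesis
    by (simp add: euclidean_product_topology)
qed

text \<open>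
  Koenig's lemma for a finitely branching tree of codes: finite approximations of every length yield
  an infinite branch.
\<close>

lemma koenig_nat_box:
  fixes N :: "nat \<Rightarrow> nat"
  assumes ex: "\<And>k. \<exists>x. (\<forall>i. x i \<le> N i) \<and> G k x"
    and finitary: "\<And>k x y. G k x \<Longrightarrow> (\<forall>i<k. y i = x i) \<Longrightarrow> G k y"
    and antimono: "\<And>j k x. j \<le> k \<Longrightarrow> G k x \<Longrightarrow> G j x"
  shows "\<exists>x. \<forall>k. G k x"
proof -
  obtain X where X: "\<And>k i. X k i \<le> N i" "\<And>k. G k (X k)"
    using ex by metis
  have "seq_compact {x. \<forall>i. x i \<le> N i}"
    by (intro compact_imp_seq_compact compact_nat_box)
  moreover have "\<forall>k. X k \<in> {x. \<forall>i. x i \<le> N i}" using X(1) by simp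
  ultimately obtain x r where r: "strict_mono r" and lim: "(X \<circ> r) \<longlonglongrightarrow> x"
    by (rule seq_compactE)
  have "G k x" for k
  proof -
    have "\<forall>\<^sub>F n in sequentially. (X \<circ> r) n i = x i" for i
    proof -
      have "(\<lambda>n. (X \<circ> r) n i) \<longlonglongrightarrow> x i"
        using continuous_on_tendsto_compose[OF continuous_on_product_coordinates[of i] lim] by simp
      then show ?thesis
        by (simp add: nhds_discrete filterlim_principal)
    qed
    then have "\<forall>\<^sub>F n in sequentially. \<forall>i\<in>{..<k}. (X \<circ> r) n i = x i"
      by (intro eventually_ball_finite) auto
    then have "\<forall>\<^sub>F n in sequentially. (\<forall>i<k. (X \<circ> r) n i = x i) \<and> k \<le> n"
      using eventually_ge_at_top[of k] by eventually_elim auto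
    then obtain n where n: "\<forall>i<k. X (r n) i = x i" "k \<le> n"
      by (auto simp: eventually_sequentially)
    have "G k (X (r n))"
      using antimono[OF _ X(2)] n(2) seq_suble[OF r, of n] by simp
    then show ?thesis using finitary n(1) by metis
  qed
  then show ?thesis by blast
qed

text \<open>
  This is the capacity argument. The outer measure is continuous along increasing unions of arbitrary sets,
  so the code coordinates can be bounded one after the other, \<open>x i \<le> N i\<close>, while the outer measure of the
  projection stays above \<open>c\<close>. Once all coordinates are bounded, the codes form a compact set: the set
  \<open>D k\<close> of points \<open>w\<close> that satisfy, for some bounded code, the constraints decided by \<open>k\<close> coordinates
  is a finite union of measurable sets, and by Koenig's lemma the intersection of the \<open>D k\<close> lies in
  the projection.
\<close>

lemma suslin_projection_inner_approx:
  fixes R :: "nat \<Rightarrow> (nat \<Rightarrow> nat) \<Rightarrow> 'w set \<times> 'q::complete_space set"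
  assumes fin: "finite_measure M" and R: "suslin_scheme M R"
    and c: "c < outer_measure_of M (fst ` suslin_kernel R)"
  shows "\<exists>D\<in>sets M. D \<subseteq> fst ` suslin_kernel R \<and> c \<le> emeasure M D"
proof -
  interpret finite_measure M by fact
  have R_sets: "fst (R m x) \<in> sets M" and R_closed: "closed (snd (R m x))"
    and R_lc: "locally_constant (R m)" for m x
    using R unfolding suslin_scheme_def by auto
  \<comment> \<open>The part of the projection that is reached with the first \<open>k\<close> code coordinates bounded by \<open>N\<close>.\<close>
  define sel where "sel k N = {w. \<exists>x q. (\<forall>i<k. x i \<le> N i) \<and> (\<forall>m. w \<in> fst (R m x) \<and> q \<in> snd (R m x))}"
    for k and N :: "nat \<Rightarrow> nat"
  have sel_space: "sel k N \<subseteq> space M" for k N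
    unfolding sel_def using R_sets sets.sets_into_space by blast
  have sel_0: "sel 0 N = fst ` suslin_kernel R" for N
    unfolding sel_def suslin_kernel_def by (auto simp: image_iff; blast)
  have sel_cong: "sel k N = sel k N'" if "\<forall>i<k. N i = N' i" for k N N'
    unfolding sel_def using that by auto
  have sel_UN: "sel k N = (\<Union>n. sel (Suc k) (N(k := n)))" for k N
  proof (intro set_eqI iffI)
    fix w assume "w \<in> sel k N"
    then obtain x q where "\<forall>i<k. x i \<le> N i" "\<forall>m. w \<in> fst (R m x) \<and> q \<in> snd (R m x)"
      unfolding sel_def by blast
    then have "w \<in> sel (Suc k) (N(k := x k))"
      unfolding sel_def mem_Collect_eq by (intro exI[of _ x] exI[of _ q]) (auto simp: less_Suc_eq)
    then show "w \<in> (\<Union>n. sel (Suc k) (N(k := n)))" by blast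
  next
    fix w assume "w \<in> (\<Union>n. sel (Suc k) (N(k := n)))"
    then obtain n x q where "\<forall>i<Suc k. x i \<le> (N(k := n)) i" "\<forall>m. w \<in> fst (R m x) \<and> q \<in> snd (R m x)"
      unfolding sel_def by blast
    then show "w \<in> sel k N"
      unfolding sel_def mem_Collect_eq
      by (intro exI[of _ x] exI[of _ q]) (auto simp: less_Suc_eq split: if_splits)
  qed
  have sel_mono: "sel k N \<subseteq> sel k N'" if "\<And>i. N i \<le> N' i" for k N N'
    unfolding sel_def using that by (blast intro: order_trans)
  have sel_incseq: "incseq (\<lambda>n. sel (Suc k) (N(k := n)))" for k N
    unfolding incseq_def by (intro allI impI sel_mono) auto
  have "\<exists>f. \<forall>k. c < outer_measure_of M (sel k (f k)) \<and> (\<forall>i<k. f (Suc k) i = f k i)"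
  proof (rule dependent_nat_choice)
    show "\<exists>N. c < outer_measure_of M (sel 0 N)"
      using c by (simp add: sel_0)
  next
    fix N k assume "c < outer_measure_of M (sel k N)"
    also have "\<dots> = (SUP n. outer_measure_of M (sel (Suc k) (N(k := n))))"
      by (subst sel_UN) (rule SUP_outer_measure_of_incseq[OF sel_space sel_incseq, symmetric])
    finally obtain n where "c < outer_measure_of M (sel (Suc k) (N(k := n)))"
      by (auto simp: less_SUP_iff)
    then show "\<exists>N'. c < outer_measure_of M (sel (Suc k) N') \<and> (\<forall>i<k. N' i = N i)"
      by (intro exI[of _ "N(k := n)"]) auto
  qed
  then obtain f where f: "\<And>k. c < outer_measure_of M (sel k (f k))" "\<And>k i. i < k \<Longrightarrow> f (Suc k) i = f k i"
    by blast
  define N where "N i = f (Suc i) i" for i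
  have "f k i = N i" if "i < k" for i k
    using that by (induction k) (auto simp: N_def less_Suc_eq f(2))
  then have sel_N: "c < outer_measure_of M (sel k N)" for k
    using f(1)[of k] sel_cong[of k "f k" N] by simp
  \<comment> \<open>The constraints among the first \<open>k + 1\<close> that are settled by the first \<open>k\<close> coordinates of \<open>x\<close>.\<close>
  define dec where "dec k x = {m. m \<le> k \<and> (\<forall>y. (\<forall>i<k. y i = x i) \<longrightarrow> R m y = R m x)}"
    for k and x :: "nat \<Rightarrow> nat"
  have dec_cong: "dec k x = dec k y" if "\<forall>i<k. x i = y i" for k x y
  proof -
    have "(\<forall>i<k. z i = x i) \<longleftrightarrow> (\<forall>i<k. z i = y i)" for z
      using that by auto
    moreover have "(\<forall>z. (\<forall>i<k. z i = y i) \<longrightarrow> R m z = R m x) \<longleftrightarrow> (\<forall>z. (\<forall>i<k. z i = y i) \<longrightarrow> R m z = R m y)" for m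
      using that by metis
    ultimately show ?thesis
      unfolding dec_def by simp
  qed
  have dec_R: "R m y = R m x" if "\<forall>i<k. y i = x i" "m \<in> dec k x" for k x y m
    using that unfolding dec_def by blast
  have dec_mono: "dec j x \<subseteq> dec k x" if "j \<le> k" for j k x
  proof
    fix m assume m: "m \<in> dec j x"
    have "R m y = R m x" if "\<forall>i<k. y i = x i" for y
      by (rule dec_R[OF _ m]) (use that \<open>j \<le> k\<close> in auto)
    then have "\<forall>y. (\<forall>i<k. y i = x i) \<longrightarrow> R m y = R m x" by blast
    moreover have "m \<le> k" using m \<open>j \<le> k\<close> unfolding dec_def by force
    ultimately show "m \<in> dec k x" unfolding dec_def by blast
  qed
  have dec_fin: "finite (dec k x)" for k x
    by (rule finite_subset[of _ "{..k}"]) (auto simp: dec_def)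
  have dec_ex: "\<exists>k. m \<in> dec k x" for m x
  proof -
    obtain l where l: "\<And>y. (\<forall>i<l. y i = x i) \<Longrightarrow> R m y = R m x"
      using R_lc[of m] unfolding locally_constant_def by meson
    have "R m y = R m x" if "\<forall>i<max l m. y i = x i" for y
      using that by (intro l) auto
    then have "\<forall>y. (\<forall>i<max l m. y i = x i) \<longrightarrow> R m y = R m x" by blast
    moreover have "m \<le> max l m" by simp
    ultimately have "m \<in> dec (max l m) x" unfolding dec_def by blast
    then show ?thesis by blast
  qed
  \<comment> \<open>What can be said about \<open>w\<close> from \<open>k\<close> coordinates of a code. For the second component, only
      compatibility of the closed sets is required; the point \<open>q\<close> appears in the limit.\<close>
  define G where "G w k x \<longleftrightarrow> w \<in> space M \<and> (\<forall>m\<in>dec k x. w \<in> fst (R m x)) \<and> (\<Inter>m\<in>dec k x. snd (R m x)) \<noteq> {}"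
    for w k x
  have G_cong: "G w k y" if G: "G w k x" and that: "\<forall>i<k. y i = x i" for w k x y
  proof -
    have "(\<Inter>m\<in>dec k x. snd (R m x)) = (\<Inter>m\<in>dec k x. snd (R m y))"
      using dec_R[OF that] by simp
    then show ?thesis
      using G dec_cong[of k y x] dec_R[OF that] that unfolding G_def by simp
  qed
  have G_antimono: "G w j x" if "j \<le> k" "G w k x" for w j k x
    using dec_mono[OF that(1), of x] that(2) unfolding G_def by blast
  define D where "D k = {w. \<exists>x. (\<forall>i. x i \<le> N i) \<and> G w k x}" for k
  have D_sets: "D k \<in> sets M" for k
  proof -
    \<comment> \<open>Since \<open>G w k\<close> looks at \<open>k\<close> coordinates only, finitely many codes suffice: those that vanish
        from \<open>k\<close> on.\<close>
    define T where "T = {x. (\<forall>i<k. x i \<le> N i) \<and> (\<forall>i\<ge>k. x i = 0)}"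
    have "T \<subseteq> (\<lambda>g i. if i < k then g i else 0) ` (PiE {..<k} (\<lambda>i. {..N i}))"
    proof
      fix x assume x: "x \<in> T"
      show "x \<in> (\<lambda>g i. if i < k then g i else 0) ` (PiE {..<k} (\<lambda>i. {..N i}))"
        by (rule image_eqI[of _ _ "restrict x {..<k}"]) (use x in \<open>auto simp: T_def fun_eq_iff\<close>)
    qed
    then have "finite T"
      by (rule finite_subset) (intro finite_imageI finite_PiE; simp)
    have "D k = (\<Union>x\<in>T. {w. G w k x})"
    proof (intro set_eqI iffI)
      fix w assume "w \<in> D k"
      then obtain x where x: "\<forall>i. x i \<le> N i" "G w k x" unfolding D_def by blast
      then have "G w k (\<lambda>i. if i < k then x i else 0)" by (intro G_cong[OF x(2)]) simp
      then show "w \<in> (\<Union>x\<in>T. {w. G w k x})"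
        using x(1) by (intro UN_I[of "\<lambda>i. if i < k then x i else 0"]) (auto simp: T_def)
    next
      fix w assume "w \<in> (\<Union>x\<in>T. {w. G w k x})"
      then obtain x where "x \<in> T" "G w k x" by blast
      moreover have "x i \<le> N i" for i
        using \<open>x \<in> T\<close> unfolding T_def by (cases "i < k") auto
      ultimately show "w \<in> D k" unfolding D_def by blast
    qed
    also have "\<dots> \<in> sets M"
    proof (intro sets.finite_UN \<open>finite T\<close>)
      fix x
      have "{w. G w k x} = (if (\<Inter>m\<in>dec k x. snd (R m x)) \<noteq> {}
          then {w\<in>space M. \<forall>m\<in>dec k x. w \<in> fst (R m x)} else {})"
        unfolding G_def by auto
      also have "\<dots> \<in> sets M"
        using dec_fin R_sets by (auto intro!: sets.sets_Collect_finite_All)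
      finally show "{w. G w k x} \<in> sets M" .
    qed
    finally show ?thesis .
  qed
  have sel_subset_D: "sel k N \<subseteq> D k" for k
  proof
    fix w assume w: "w \<in> sel k N"
    then obtain x q where x: "\<forall>i<k. x i \<le> N i" "\<And>m. w \<in> fst (R m x)" "\<And>m. q \<in> snd (R m x)"
      unfolding sel_def by blast
    have "w \<in> space M" using w sel_space by blast
    then have "G w k x" unfolding G_def using x by blast
    then have "G w k (\<lambda>i. if i < k then x i else 0)"
      by (rule G_cong) simp
    then show "w \<in> D k" unfolding D_def using x(1) by (auto intro!: exI[of _ "\<lambda>i. if i < k then x i else 0"])
  qed
  have D_decseq: "decseq D"
    unfolding decseq_def D_def using G_antimono by blast
  have "c \<le> (INF k. emeasure M (D k))"
  proof (rule INF_greatest)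
    fix k
    have "c < outer_measure_of M (sel k N)" by (rule sel_N)
    also have "\<dots> \<le> outer_measure_of M (D k)" by (intro outer_measure_of_mono sel_subset_D)
    finally show "c \<le> emeasure M (D k)" using D_sets by simp
  qed
  also have "\<dots> = emeasure M (\<Inter>k. D k)"
    by (intro INF_emeasure_decseq D_decseq) (use D_sets emeasure_finite in auto)
  finally have "c \<le> emeasure M (\<Inter>k. D k)" .
  moreover have "(\<Inter>k. D k) \<subseteq> fst ` suslin_kernel R"
  proof
    fix w assume w: "w \<in> (\<Inter>k. D k)"
    have "\<exists>x. \<forall>k. G w k x"
    proof (rule koenig_nat_box[of N])
      show "\<exists>x. (\<forall>i. x i \<le> N i) \<and> G w k x" for k
        using w unfolding D_def by blast
    qed (fact G_cong, fact G_antimono)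
    then obtain x where x: "\<And>k. G w k x" by blast
    have w_in: "w \<in> fst (R m x)" for m
      using dec_ex[of m x] x unfolding G_def by blast
    have fip: "(\<Inter>m\<le>n. snd (R m x)) \<noteq> {}" for n
    proof -
      have "\<exists>l. \<forall>m. m \<in> dec (l m) x"
        by (intro choice allI dec_ex)
      then obtain l where l: "\<And>m. m \<in> dec (l m) x" by blast
      define k where "k = Max (l ` {..n})"
      have "m \<in> dec k x" if "m \<le> n" for m
      proof -
        have "l m \<le> k" unfolding k_def using that by (intro Max_ge) auto
        then show ?thesis using l dec_mono by blast
      qed
      moreover have "(\<Inter>m\<in>dec k x. snd (R m x)) \<noteq> {}"
        using x[of k] unfolding G_def by blast
      ultimately show ?thesis by blast
    qed
    have nested: "closed (\<Inter>m\<le>n. snd (R m x))"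
      "k \<le> n \<Longrightarrow> (\<Inter>m\<le>n. snd (R m x)) \<subseteq> (\<Inter>m\<le>k. snd (R m x))" for n k
      by (intro closed_INT ballI R_closed) (intro INF_superset_mono; auto)
    have small: "\<exists>n. \<forall>p\<in>(\<Inter>m\<le>n. snd (R m x)). \<forall>q\<in>(\<Inter>m\<le>n. snd (R m x)). dist p q < e"
      if "e > 0" for e
    proof -
      obtain m where "\<forall>p\<in>snd (R m x). \<forall>q\<in>snd (R m x). dist p q < e"
        using R \<open>e > 0\<close> unfolding suslin_scheme_def by meson
      then show ?thesis
        by (intro exI[of _ m]) auto
    qed
    obtain q where q: "\<And>n. q \<in> (\<Inter>m\<le>n. snd (R m x))"
      using decreasing_closed_nest[of "\<lambda>n. \<Inter>m\<le>n. snd (R m x)", OF nested(1) fip nested(2) small]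
      by blast
    have "q \<in> snd (R m x)" for m using q[of m] by blast
    then have "(w, q) \<in> suslin_kernel R"
      unfolding suslin_kernel_def using w_in by blast
    then show "w \<in> fst ` suslin_kernel R"
      by (intro image_eqI[of _ _ "(w, q)"]) simp_all
  qed
  ultimately show ?thesis
    using D_sets by (intro bexI[of _ "\<Inter>k. D k"]) auto
qed

text \<open>
  Measurable sets inside \<open>A\<close> exhaust its outer measure, so \<open>A\<close> differs from the union of countably many
  of them by a subset of a null set.
\<close>

lemma sets_completion_inner_approx:
  assumes fin: "finite_measure M" and A: "A \<subseteq> space M"
    and inner: "\<And>c. c < outer_measure_of M A \<Longrightarrow> \<exists>D\<in>sets M. D \<subseteq> A \<and> c \<le> emeasure M D"
  shows "A \<in> sets (completion M)"
proof -
  interpret finite_measure M by fact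
  obtain B where B: "B \<in> sets M" "A \<subseteq> B" "outer_measure_of M A = emeasure M B"
    using outer_measure_of_attain[OF A] by blast
  let ?\<D> = "{D \<in> sets M. D \<subseteq> A}"
  have "?\<D> \<noteq> {}" by blast
  from ennreal_SUP_countable_SUP[OF this, of "emeasure M"] obtain f :: "nat \<Rightarrow> ennreal"
    where f: "range f \<subseteq> emeasure M ` ?\<D>" "Sup (emeasure M ` ?\<D>) = Sup (range f)"
    by blast
  then have "\<forall>n. \<exists>D\<in>?\<D>. f n = emeasure M D" by blast
  then obtain D where D: "\<And>n. D n \<in> ?\<D>" "\<And>n. f n = emeasure M (D n)" by metis
  have "emeasure M B \<le> emeasure M (\<Union>n. D n)"
  proof (rule dense_le)
    fix c assume "c < emeasure M B"
    then obtain D' where "D' \<in> ?\<D>" "c \<le> emeasure M D'" using inner B(3) by auto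
    then have "c \<le> Sup (emeasure M ` ?\<D>)" by (auto intro: order_trans SUP_upper)
    also have "\<dots> = (SUP n. emeasure M (D n))" using f(2) D(2) by simp
    also have "\<dots> \<le> emeasure M (\<Union>n. D n)"
      using D(1) by (intro SUP_least emeasure_mono) auto
    finally show "c \<le> emeasure M (\<Union>n. D n)" .
  qed
  then have "emeasure M (B - (\<Union>n. D n)) = 0"
    using B(1,2) D(1) emeasure_finite
    by (subst emeasure_Diff) (auto intro!: diff_eq_0_ennreal simp: less_top[symmetric])
  then have "B - (\<Union>n. D n) \<in> null_sets M"
    using B(1) D(1) by (intro null_setsI) auto
  then show ?thesis
    using D(1) B(2) by (intro sets_completionI[of A "\<Union>n. D n" "A - (\<Union>n. D n)"]) auto
qed

text \<open>
  The projection of a Borel set need not be measurable for the given \<open>\<sigma>\<close>-algebra; the completion with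
  respect to some finite measure is what makes infima and suprema over uncountable sets of parameters
  measurable.
\<close>

theorem measurable_projection:
  fixes A :: "('w \<times> 'q::polish_space) set"
  assumes fin: "finite_measure M" and A: "A \<in> sets (M \<Otimes>\<^sub>M borel)"
  shows "fst ` A \<in> sets (completion M)"
proof -
  obtain R where R: "suslin_scheme M R" "A = suslin_kernel R"
    using pair_borel_in_suslin_sets[OF A] unfolding suslin_sets_def by blast
  have "fst ` A \<subseteq> space M"
    using sets.sets_into_space[OF A] by (auto simp: space_pair_measure)
  then show ?thesis
    using suslin_projection_inner_approx[OF fin R(1)] unfolding R(2)
    by (intro sets_completion_inner_approx[OF fin]) auto
qed

section \<open>The strong law of large numbers\<close>

text \<open>
  The maximum of \<open>0\<close> and the partial sums of length at most \<open>n\<close> of \<open>f (\<omega> 0), f (\<omega> 1), \<dots>\<close>. The recursion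
  peels off the first term, which is how the maximum behaves under the shift of the sequence.
\<close>

primrec max_sum :: "('a \<Rightarrow> real) \<Rightarrow> nat \<Rightarrow> (nat \<Rightarrow> 'a) \<Rightarrow> real" where
  "max_sum f 0 \<omega> = 0"
| "max_sum f (Suc n) \<omega> = max 0 (f (\<omega> 0) + max_sum f n (\<lambda>i. \<omega> (Suc i)))"

lemma max_sum_nonneg: "0 \<le> max_sum f n \<omega>"
  by (cases n) auto

lemma max_sum_mono_Suc: "max_sum f n \<omega> \<le> max_sum f (Suc n) \<omega>"
proof (induction n arbitrary: \<omega>)
  case (Suc n)
  have "max_sum f n (\<lambda>i. \<omega> (Suc i)) \<le> max_sum f (Suc n) (\<lambda>i. \<omega> (Suc i))"
    by (rule Suc.IH)
  then show ?case
    unfolding max_sum.simps(2)[of f n \<omega>] max_sum.simps(2)[of f "Suc n" \<omega>] by linarith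
qed simp

lemma sum_le_max_sum: "(\<Sum>i<n. f (\<omega> i)) \<le> max_sum f n \<omega>"
proof (induction n arbitrary: \<omega>)
  case (Suc n)
  have "(\<Sum>i<n. f (\<omega> (Suc i))) \<le> max_sum f n (\<lambda>i. \<omega> (Suc i))"
    by (rule Suc.IH)
  then show ?case
    unfolding max_sum.simps(2) sum.lessThan_Suc_shift by linarith
qed simp

lemma max_sum_le_sum_abs: "max_sum f n \<omega> \<le> (\<Sum>i<n. \<bar>f (\<omega> i)\<bar>)"
proof (induction n arbitrary: \<omega>)
  case (Suc n)
  have "max_sum f n (\<lambda>i. \<omega> (Suc i)) \<le> (\<Sum>i<n. \<bar>f (\<omega> (Suc i))\<bar>)"
    by (rule Suc.IH)
  moreover have "0 \<le> (\<Sum>i<n. \<bar>f (\<omega> (Suc i))\<bar>)" by (simp add: sum_nonneg)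
  ultimately show ?case
    unfolding max_sum.simps(2) sum.lessThan_Suc_shift by linarith
qed simp

context sequence_space
begin

text \<open>
  This is Garsia's maximal ergodic argument. Let \<open>A\<close> be the event that the running maxima \<open>M n\<close> are unbounded.
  It is invariant under prepending a term \<open>x\<close>, and \<open>M (n + 1)\<close> of the prolonged sequence is
  \<open>max 0 (f x + M n)\<close>. Prepending an independent term preserves the law of the sequence, so \<open>M n \<le> M (n + 1)\<close>
  gives \<open>0 \<le> E [max 0 (f x + M n) - M n; A] = E [max (- M n) (f x); A]\<close>. On \<open>A\<close> the integrand tends to
  \<open>f x\<close>, and \<open>x\<close> is independent of \<open>A\<close>, so that \<open>0 \<le> E f * P A\<close>; with \<open>E f < 0\<close> this forces \<open>P A = 0\<close>.
\<close>

lemma AE_sums_bounded_above: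
  fixes f :: "'a \<Rightarrow> real"
  assumes f: "integrable M f" and neg: "(\<integral>x. f x \<partial>M) < 0"
  shows "AE \<omega> in S. \<exists>B. \<forall>n. (\<Sum>i<n. f (\<omega> i)) \<le> B"
proof -
  interpret MS: pair_prob_space M S ..
  have f_meas [measurable]: "f \<in> borel_measurable M" using f by simp
  have shift [measurable]: "(\<lambda>\<omega> i. \<omega> (Suc i)) \<in> measurable S S"
    by (rule measurable_PiM_single') (auto simp: space_PiM)
  have m_meas [measurable]: "max_sum f n \<in> borel_measurable S" for n
  proof (induction n)
    case (Suc n)
    note Suc [measurable]
    show ?case by simp
  qed simp
  have component: "integrable S (\<lambda>\<omega>. f (\<omega> i))" for i
  proof -
    have "distr S M (\<lambda>\<omega>. \<omega> i) = M"
      by (rule PiM_component) simp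
    then show ?thesis
      using f integrable_distr_eq[of "\<lambda>\<omega>. \<omega> i" S M f] by simp
  qed
  have m_int: "integrable S (max_sum f n)" for n
    by (rule Bochner_Integration.integrable_bound[of _ "\<lambda>\<omega>. \<Sum>i<n. \<bar>f (\<omega> i)\<bar>"])
      (use component max_sum_le_sum_abs[of f n] max_sum_nonneg[of f n] in \<open>auto simp: sum_nonneg\<close>)
  define A where "A = {\<omega> \<in> space S. \<forall>b::nat. \<exists>n. real b < max_sum f n \<omega>}"
  have A [measurable]: "A \<in> sets S" unfolding A_def by measurable
  have A_shift: "case_nat x \<omega> \<in> A \<longleftrightarrow> \<omega> \<in> A" if "x \<in> space M" "\<omega> \<in> space S" for x \<omega>
  proof
    assume "case_nat x \<omega> \<in> A"
    show "\<omega> \<in> A"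
      unfolding A_def
    proof (intro CollectI conjI allI)
      fix b :: nat
      obtain c :: nat where c: "real b + \<bar>f x\<bar> < real c" using reals_Archimedean2 by blast
      obtain n where "real c < max_sum f n (case_nat x \<omega>)"
        using \<open>case_nat x \<omega> \<in> A\<close> unfolding A_def by blast
      then have "real c < max_sum f (Suc n) (case_nat x \<omega>)"
        using max_sum_mono_Suc[of f n] by (rule less_le_trans)
      then have "real b < max_sum f n \<omega>" using c by (simp add: max_def split: if_splits)
      then show "\<exists>n. real b < max_sum f n \<omega>" by blast
    qed (use that in simp)
  next
    assume "\<omega> \<in> A"
    show "case_nat x \<omega> \<in> A"
      unfolding A_def
    proof (intro CollectI conjI allI)
      show "case_nat x \<omega> \<in> space S"
        using that by (auto simp: space_PiM PiE_iff split: nat.split)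
      fix b :: nat
      obtain c :: nat where c: "real b + \<bar>f x\<bar> < real c" using reals_Archimedean2 by blast
      obtain n where "real c < max_sum f n \<omega>"
        using \<open>\<omega> \<in> A\<close> unfolding A_def by blast
      then have "real b < max_sum f (Suc n) (case_nat x \<omega>)" using c by simp
      then show "\<exists>n. real b < max_sum f n (case_nat x \<omega>)" by blast
    qed
  qed
  have snd_distr: "distr (M \<Otimes>\<^sub>M S) S snd = S"
  proof -
    have "distr (M \<Otimes>\<^sub>M S) S snd = distr (distr (S \<Otimes>\<^sub>M M) (M \<Otimes>\<^sub>M S) (\<lambda>(x, y). (y, x))) S snd"
      by (simp add: MS.distr_pair_swap[symmetric])
    also have "\<dots> = distr (S \<Otimes>\<^sub>M M) S fst"
      by (subst distr_distr) (auto simp: comp_def case_prod_unfold)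
    finally show ?thesis by (simp add: M.distr_pair_fst)
  qed
  have f_fst: "integrable (M \<Otimes>\<^sub>M S) (\<lambda>p. f (fst p))"
    using f distr_pair_fst[of M] integrable_distr_eq[of fst "M \<Otimes>\<^sub>M S" M f] by simp
  have nonneg: "0 \<le> (\<integral>p. max (- max_sum f n (snd p)) (f (fst p)) * indicat_real A (snd p) \<partial>(M \<Otimes>\<^sub>M S))"
    for n
  proof -
    have int_A: "integrable S (\<lambda>\<omega>. max_sum f k \<omega> * indicat_real A \<omega>)" for k
      using integrable_mult_indicator[OF A m_int[of k]] by (simp add: mult.commute)
    have "(\<integral>\<omega>. max_sum f n \<omega> * indicat_real A \<omega> \<partial>S) \<le> (\<integral>\<omega>. max_sum f (Suc n) \<omega> * indicat_real A \<omega> \<partial>S)"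
      by (intro integral_mono int_A mult_right_mono max_sum_mono_Suc) simp
    also have "(\<integral>\<omega>. max_sum f (Suc n) \<omega> * indicat_real A \<omega> \<partial>S)
        = (\<integral>\<omega>. max_sum f (Suc n) \<omega> * indicat_real A \<omega> \<partial>distr (M \<Otimes>\<^sub>M S) S (\<lambda>(x, \<omega>). case_nat x \<omega>))"
      by (simp only: PiM_iter)
    also have "\<dots> = (\<integral>p. max 0 (f (fst p) + max_sum f n (snd p)) * indicat_real A (snd p) \<partial>(M \<Otimes>\<^sub>M S))"
      by (subst integral_distr)
        (auto simp: space_pair_measure case_prod_unfold A_shift indicator_def intro!: Bochner_Integration.integral_cong)
    finally have *: "(\<integral>\<omega>. max_sum f n \<omega> * indicat_real A \<omega> \<partial>S)
      \<le> (\<integral>p. max 0 (f (fst p) + max_sum f n (snd p)) * indicat_real A (snd p) \<partial>(M \<Otimes>\<^sub>M S))" .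
    have int_snd: "integrable (M \<Otimes>\<^sub>M S) (\<lambda>p. max_sum f n (snd p) * indicat_real A (snd p))"
      using int_A[of n] snd_distr
        integrable_distr_eq[of snd "M \<Otimes>\<^sub>M S" S "\<lambda>\<omega>. max_sum f n \<omega> * indicat_real A \<omega>"] by simp
    have int_fold: "(\<integral>\<omega>. max_sum f n \<omega> * indicat_real A \<omega> \<partial>S)
      = (\<integral>p. max_sum f n (snd p) * indicat_real A (snd p) \<partial>(M \<Otimes>\<^sub>M S))"
      using snd_distr integral_distr[of snd "M \<Otimes>\<^sub>M S" S "\<lambda>\<omega>. max_sum f n \<omega> * indicat_real A \<omega>"] by simp
    have eq: "max (- max_sum f n (snd p)) (f (fst p)) * indicat_real A (snd p)
      = max 0 (f (fst p) + max_sum f n (snd p)) * indicat_real A (snd p)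
        - max_sum f n (snd p) * indicat_real A (snd p)" for p
      by (simp add: max_def algebra_simps)
    have "integrable (M \<Otimes>\<^sub>M S) (\<lambda>p. max 0 (f (fst p) + max_sum f n (snd p)) * indicat_real A (snd p))"
      by (rule Bochner_Integration.integrable_bound[OF Bochner_Integration.integrable_add[OF integrable_abs[OF f_fst] int_snd]])
        (use max_sum_nonneg[of f n] in \<open>auto simp: indicator_def intro!: AE_I2\<close>)
    then have "(\<integral>p. max (- max_sum f n (snd p)) (f (fst p)) * indicat_real A (snd p) \<partial>(M \<Otimes>\<^sub>M S))
      = (\<integral>p. max 0 (f (fst p) + max_sum f n (snd p)) * indicat_real A (snd p) \<partial>(M \<Otimes>\<^sub>M S))
       - (\<integral>p. max_sum f n (snd p) * indicat_real A (snd p) \<partial>(M \<Otimes>\<^sub>M S))"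
      using int_snd eq by (simp only: Bochner_Integration.integral_diff)
    then show ?thesis using * int_fold by linarith
  qed
  have "(\<lambda>n. \<integral>p. max (- max_sum f n (snd p)) (f (fst p)) * indicat_real A (snd p) \<partial>(M \<Otimes>\<^sub>M S))
    \<longlonglongrightarrow> (\<integral>p. f (fst p) * indicat_real A (snd p) \<partial>(M \<Otimes>\<^sub>M S))"
  proof (rule integral_dominated_convergence[where w = "\<lambda>p. \<bar>f (fst p)\<bar>"])
    show "AE p in M \<Otimes>\<^sub>M S. (\<lambda>n. max (- max_sum f n (snd p)) (f (fst p)) * indicat_real A (snd p))
        \<longlonglongrightarrow> f (fst p) * indicat_real A (snd p)"
    proof (intro AE_I2)
      fix p
      show "(\<lambda>n. max (- max_sum f n (snd p)) (f (fst p)) * indicat_real A (snd p))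
          \<longlonglongrightarrow> f (fst p) * indicat_real A (snd p)"
      proof (cases "snd p \<in> A")
        case True
        obtain b :: nat where b: "- f (fst p) < real b" using reals_Archimedean2 by blast
        obtain k where k: "real b < max_sum f k (snd p)" using True unfolding A_def by blast
        have "max (- max_sum f n (snd p)) (f (fst p)) = f (fst p)" if "k \<le> n" for n
        proof -
          have "max_sum f k (snd p) \<le> max_sum f n (snd p)"
            using max_sum_mono_Suc that by (rule lift_Suc_mono_le)
          then show ?thesis using b k by simp
        qed
        then have "\<forall>\<^sub>F n in sequentially. max (- max_sum f n (snd p)) (f (fst p)) = f (fst p)"
          unfolding eventually_sequentially by blast
        then show ?thesis
          by (intro tendsto_eventually) (auto elim: eventually_mono)
      qed simp
    qed
    show "AE p in M \<Otimes>\<^sub>M S. norm (max (- max_sum f n (snd p)) (f (fst p)) * indicat_real A (snd p))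
        \<le> \<bar>f (fst p)\<bar>" for n
    proof (intro AE_I2)
      fix p
      show "norm (max (- max_sum f n (snd p)) (f (fst p)) * indicat_real A (snd p)) \<le> \<bar>f (fst p)\<bar>"
        using max_sum_nonneg[of f n "snd p"] by (auto simp: indicator_def max_def)
    qed
  qed (use f_fst in auto)
  with nonneg have "0 \<le> (\<integral>p. f (fst p) * indicat_real A (snd p) \<partial>(M \<Otimes>\<^sub>M S))"
    by (intro LIMSEQ_le_const) auto
  also have "\<dots> = (\<integral>x. (\<integral>\<omega>. f x * indicat_real A \<omega> \<partial>S) \<partial>M)"
  proof -
    have "integrable (M \<Otimes>\<^sub>M S) (\<lambda>p. f (fst p) * indicat_real A (snd p))"
      by (rule Bochner_Integration.integrable_bound[OF f_fst])
        (auto simp: indicator_def intro!: AE_I2)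
    then show ?thesis
      using MS.integral_fst'[of "\<lambda>p. f (fst p) * indicat_real A (snd p)", symmetric]
      by (simp only: fst_conv snd_conv)
  qed
  also have "\<dots> = (\<integral>x. f x \<partial>M) * measure S A"
    by simp
  finally have "measure S A = 0"
    using neg by (auto simp: zero_le_mult_iff measure_le_0_iff)
  then have "AE \<omega> in S. \<omega> \<notin> A"
    using A by (intro AE_not_in null_setsI) (auto simp: emeasure_eq_measure)
  then show ?thesis
    using AE_space
  proof eventually_elim
    case (elim \<omega>)
    then obtain b :: nat where "\<And>n. max_sum f n \<omega> \<le> real b"
      unfolding A_def by (auto simp: not_less)
    then show ?case
      using sum_le_max_sum[of f \<omega>] by (meson order_trans)
  qed
qed


text \<open>
  Subtracting a constant \<open>b\<close> with \<open>E f < b < a\<close> makes the mean negative; the sums of \<open>f - b\<close> are then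
  bounded above, and the averages of \<open>f\<close> exceed \<open>b\<close> by \<open>O(1 / n)\<close> at most.
\<close>

lemma AE_averages_eventually_less:
  fixes f :: "'a \<Rightarrow> real"
  assumes f: "integrable M f" and less: "(\<integral>x. f x \<partial>M) < a"
  shows "AE \<omega> in S. \<forall>\<^sub>F n in sequentially. (\<Sum>i<n. f (\<omega> i)) / real n < a"
proof -
  obtain b where b: "(\<integral>x. f x \<partial>M) < b" "b < a" using dense[OF less] by blast
  have "integrable M (\<lambda>x. f x - b)" using f by simp
  moreover have "(\<integral>x. f x - b \<partial>M) < 0" using f b by (simp add: M.prob_space)
  ultimately have "AE \<omega> in S. \<exists>B. \<forall>n. (\<Sum>i<n. f (\<omega> i) - b) \<le> B"
    by (rule AE_sums_bounded_above)
  then show ?thesis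
  proof eventually_elim
    case (elim \<omega>)
    then obtain B where B: "\<And>n. (\<Sum>i<n. f (\<omega> i)) - real n * b \<le> B"
      by (auto simp: sum_subtractf)
    have "\<forall>\<^sub>F n in sequentially. B / (a - b) < real n"
      using filterlim_real_sequentially by (simp add: filterlim_at_top_dense)
    then show ?case
      using eventually_gt_at_top[of 0]
    proof eventually_elim
      case (elim n)
      have "(\<Sum>i<n. f (\<omega> i)) \<le> B + real n * b" using B[of n] by simp
      also have "\<dots> < real n * a" using elim b by (simp add: field_simps)
      finally show ?case using elim by (simp add: field_simps)
    qed
  qed
qed

text \<open>The upper bound is applied to \<open>f\<close> and to \<open>- f\<close>, with margins \<open>1 / (k + 1)\<close>.\<close>

theorem strong_law_of_large_numbers:
  fixes f :: "'a \<Rightarrow> real"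
  assumes f: "integrable M f"
  shows "AE \<omega> in S. (\<lambda>n. (\<Sum>i<n. f (\<omega> i)) / real n) \<longlonglongrightarrow> (\<integral>x. f x \<partial>M)"
proof -
  let ?m = "\<integral>x. f x \<partial>M" and ?e = "\<lambda>k. inverse (real (Suc k))"
  have "AE \<omega> in S. \<forall>k. \<forall>\<^sub>F n in sequentially. (\<Sum>i<n. f (\<omega> i)) / real n < ?m + ?e k"
    unfolding AE_all_countable by (intro allI AE_averages_eventually_less f) simp
  moreover have "AE \<omega> in S. \<forall>k. \<forall>\<^sub>F n in sequentially. (\<Sum>i<n. - f (\<omega> i)) / real n < - ?m + ?e k"
    unfolding AE_all_countable
    by (intro allI AE_averages_eventually_less[of "\<lambda>x. - f x"]) (use f in auto)
  ultimately show ?thesis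
  proof eventually_elim
    case (elim \<omega>)
    show ?case
    proof (rule LIMSEQ_I)
      fix r :: real assume "r > 0"
      then obtain k where k: "?e k < r" using reals_Archimedean by blast
      have "\<forall>\<^sub>F n in sequentially. norm ((\<Sum>i<n. f (\<omega> i)) / real n - ?m) < r"
        using elim(1)[rule_format, of k] elim(2)[rule_format, of k]
      proof eventually_elim
        case (elim n)
        then show ?case using k by (simp add: sum_negf abs_less_iff)
      qed
      then show "\<exists>N. \<forall>n\<ge>N. norm ((\<Sum>i<n. f (\<omega> i)) / real n - ?m) < r"
        by (simp add: eventually_sequentially)
    qed
  qed
qed

end

text \<open>
  An independent sequence with common law \<open>\<mu>\<close> has the infinite product of \<open>\<mu>\<close> as its joint law. The
  sequence is indexed from \<open>1\<close>, so it is shifted by one on the way.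
\<close>

theorem (in prob_space) strong_law_of_large_numbers_iid:
  fixes X :: "nat \<Rightarrow> 'a \<Rightarrow> 'b" and g :: "'b \<Rightarrow> real"
  assumes indep: "indep_vars (\<lambda>_. N) X {1..}"
    and distr: "\<And>i. i \<ge> 1 \<Longrightarrow> distr M N (X i) = \<mu>"
    and g: "integrable \<mu> g"
  shows "AE \<omega> in M. (\<lambda>n. 1 / real n * (\<Sum>i=1..n. g (X i \<omega>))) \<longlonglongrightarrow> (\<integral>y. g y \<partial>\<mu>)"
proof -
  have X [measurable]: "X i \<in> measurable M N" if "i \<ge> 1" for i
    using indep that unfolding indep_vars_def by auto
  have sets_\<mu>: "sets \<mu> = sets N"
    using distr[of 1] by (metis order_refl sets_distr)
  have space_\<mu>: "space \<mu> = space N"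
    by (rule sets_eq_imp_space_eq[OF sets_\<mu>])
  have "prob_space (distr M N (X 1))"
    by (intro prob_space_distr X) simp
  then have "prob_space \<mu>"
    using distr[of 1] by simp
  interpret seq: sequence_space \<mu>
    by (intro sequence_space.intro product_prob_spaceI) fact
  define \<Xi> where "\<Xi> \<omega> i = X (Suc i) \<omega>" for \<omega> i
  have \<Xi>_meas: "\<Xi> \<in> measurable M (PiM UNIV (\<lambda>_. \<mu>))"
    unfolding \<Xi>_def
    by (rule measurable_PiM_single') (use measurable_space[OF X] in \<open>auto simp: measurable_cong_sets[OF refl sets_\<mu>] space_\<mu>\<close>)
  have "distr M (PiM UNIV (\<lambda>_. \<mu>)) \<Xi> = PiM UNIV (\<lambda>_. \<mu>)"
  proof -
    let ?r = "\<lambda>\<xi>. \<lambda>n\<in>UNIV. \<xi> (Suc n)" and ?X = "\<lambda>\<omega>. \<lambda>i\<in>{1..}. X i \<omega>"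
    have "PiM UNIV (\<lambda>_. \<mu>) = distr (PiM {1..} (\<lambda>_. \<mu>)) (PiM UNIV (\<lambda>_. \<mu>)) ?r"
      by (rule distr_PiM_reindex[symmetric]) (use \<open>prob_space \<mu>\<close> in auto)
    also have "PiM {1..} (\<lambda>_. \<mu>) = PiM {1..} (\<lambda>i. distr M N (X i))"
      by (intro PiM_cong) (auto simp: distr)
    also have "\<dots> = distr M (PiM {1..} (\<lambda>_. N)) ?X"
      using indep by (subst (asm) indep_vars_iff_distr_eq_PiM') auto
    also have "distr \<dots> (PiM UNIV (\<lambda>_. \<mu>)) ?r = distr M (PiM UNIV (\<lambda>_. \<mu>)) (?r \<circ> ?X)"
    proof (rule distr_distr)
      have "?r \<in> measurable (PiM {1..} (\<lambda>_. N)) (PiM UNIV (\<lambda>_. N))"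
        by (intro measurable_restrict) auto
      also have "measurable (PiM {1..} (\<lambda>_. N)) (PiM UNIV (\<lambda>_. N))
          = measurable (PiM {1..} (\<lambda>_. N)) (PiM UNIV (\<lambda>_. \<mu>))"
        by (intro measurable_cong_sets sets_PiM_cong) (auto simp: sets_\<mu>)
      finally show "?r \<in> measurable (PiM {1..} (\<lambda>_. N)) (PiM UNIV (\<lambda>_. \<mu>))" .
      show "?X \<in> measurable M (PiM {1..} (\<lambda>_. N))"
        by (intro measurable_restrict) auto
    qed
    also have "?r \<circ> ?X = \<Xi>" by (auto simp: \<Xi>_def fun_eq_iff)
    finally show ?thesis by simp
  qed
  then have "AE \<xi> in distr M (PiM UNIV (\<lambda>_. \<mu>)) \<Xi>. (\<lambda>n. (\<Sum>i<n. g (\<xi> i)) / real n) \<longlonglongrightarrow> (\<integral>y. g y \<partial>\<mu>)"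
    by (rule ssubst) (rule seq.strong_law_of_large_numbers[OF g])
  from AE_distrD[OF \<Xi>_meas this] show ?thesis
    unfolding \<Xi>_def
    by eventually_elim (simp add: sum.atLeast1_atMost_eq)
qed

section \<open>Infima of the cost over small balls\<close>

text \<open>
  An infimum over \<open>q\<close> is below \<open>a\<close> if and only if some value is, so its strict sublevel sets are
  projections; likewise for suprema.
\<close>

lemma borel_measurable_INF_completion:
  fixes c :: "'y \<Rightarrow> 'q::polish_space \<Rightarrow> 'b::{complete_linorder, linorder_topology, second_countable_topology}"
  assumes fin: "finite_measure M" and U: "U \<in> sets borel"
    and c: "(\<lambda>(y, q). c y q) \<in> borel_measurable (M \<Otimes>\<^sub>M borel)"
  shows "(\<lambda>y. INF q\<in>U. c y q) \<in> borel_measurable (completion M)"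
proof (rule borel_measurableI_less)
  fix a
  let ?A = "{p \<in> space (M \<Otimes>\<^sub>M borel). (case p of (y, q) \<Rightarrow> c y q) < a} \<inter> space M \<times> U"
  have "?A \<in> sets (M \<Otimes>\<^sub>M borel)"
    using U c by (intro sets.Int borel_measurable_less) auto
  moreover have "{y \<in> space (completion M). (INF q\<in>U. c y q) < a} = fst ` ?A"
  proof (intro set_eqI iffI)
    fix y assume "y \<in> {y \<in> space (completion M). (INF q\<in>U. c y q) < a}"
    then obtain q where "y \<in> space M" "q \<in> U" "c y q < a" by (auto simp: INF_less_iff)
    then show "y \<in> fst ` ?A"
      by (intro image_eqI[of _ _ "(y, q)"]) (auto simp: space_pair_measure)
  next
    fix y assume "y \<in> fst ` ?A"
    then obtain q where "y \<in> space M" "q \<in> U" "c y q < a" by auto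
    then show "y \<in> {y \<in> space (completion M). (INF q\<in>U. c y q) < a}"
      by (auto simp: INF_less_iff)
  qed
  ultimately show "{y \<in> space (completion M). (INF q\<in>U. c y q) < a} \<in> sets (completion M)"
    using measurable_projection[OF fin] by simp
qed

lemma borel_measurable_SUP_completion:
  fixes c :: "'y \<Rightarrow> 'q::polish_space \<Rightarrow> 'b::{complete_linorder, linorder_topology, second_countable_topology}"
  assumes fin: "finite_measure M" and U: "U \<in> sets borel"
    and c: "(\<lambda>(y, q). c y q) \<in> borel_measurable (M \<Otimes>\<^sub>M borel)"
  shows "(\<lambda>y. SUP q\<in>U. c y q) \<in> borel_measurable (completion M)"
proof (rule borel_measurableI_greater)
  fix a
  let ?A = "{p \<in> space (M \<Otimes>\<^sub>M borel). a < (case p of (y, q) \<Rightarrow> c y q)} \<inter> space M \<times> U"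
  have "?A \<in> sets (M \<Otimes>\<^sub>M borel)"
    using U c by (intro sets.Int borel_measurable_less) auto
  moreover have "{y \<in> space (completion M). a < (SUP q\<in>U. c y q)} = fst ` ?A"
  proof (intro set_eqI iffI)
    fix y assume "y \<in> {y \<in> space (completion M). a < (SUP q\<in>U. c y q)}"
    then obtain q where "y \<in> space M" "q \<in> U" "a < c y q" by (auto simp: less_SUP_iff)
    then show "y \<in> fst ` ?A"
      by (intro image_eqI[of _ _ "(y, q)"]) (auto simp: space_pair_measure)
  next
    fix y assume "y \<in> fst ` ?A"
    then obtain q where "y \<in> space M" "q \<in> U" "a < c y q" by auto
    then show "y \<in> {y \<in> space (completion M). a < (SUP q\<in>U. c y q)}"
      by (auto simp: less_SUP_iff)
  qed
  ultimately show "{y \<in> space (completion M). a < (SUP q\<in>U. c y q)} \<in> sets (completion M)"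
    using measurable_projection[OF fin] by simp
qed

text \<open>
  Although \<open>H\<close> is only measurable for the completed law of \<open>Y\<close>, the transformation rule holds: \<open>H\<close> agrees
  almost everywhere with a measurable function.
\<close>

lemma nn_integral_completion_distr:
  assumes Y: "Y \<in> measurable P S" and H: "H \<in> borel_measurable (completion (distr P S Y))"
  shows "(\<integral>\<^sup>+\<omega>. H (Y \<omega>) \<partial>completion P) = (\<integral>\<^sup>+y. H y \<partial>distr P S Y)"
proof -
  obtain H' where H': "H' \<in> borel_measurable (distr P S Y)" "AE y in distr P S Y. H y = H' y"
    using completion_ex_borel_measurable[OF H] by blast
  have "(\<integral>\<^sup>+\<omega>. H (Y \<omega>) \<partial>completion P) = (\<integral>\<^sup>+\<omega>. H' (Y \<omega>) \<partial>P)"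
    unfolding nn_integral_completion by (intro nn_integral_cong_AE AE_distrD[OF Y H'(2)])
  also have "\<dots> = (\<integral>\<^sup>+y. H' y \<partial>distr P S Y)"
    using H'(1) Y by (subst nn_integral_distr) auto
  also have "\<dots> = (\<integral>\<^sup>+y. H y \<partial>distr P S Y)"
    by (intro nn_integral_cong_AE) (use H'(2) in auto)
  finally show ?thesis .
qed

context prob_space
begin

lemma AE_all_identically_distributed:
  assumes X: "\<And>i. i \<ge> (1::nat) \<Longrightarrow> X i \<in> measurable M N" "\<And>i. i \<ge> 1 \<Longrightarrow> distr M N (X i) = \<mu>"
    and Q: "AE y in \<mu>. Q y"
  shows "AE \<omega> in M. \<forall>i\<ge>1. Q (X i \<omega>)"
proof -
  have "AE \<omega> in M. i \<ge> 1 \<longrightarrow> Q (X i \<omega>)" for i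
    using AE_distrD[OF X(1), of i Q] X(2)[of i] Q by (cases "i \<ge> 1") auto
  then show ?thesis by (simp add: AE_all_countable)
qed

lemma strong_law_of_large_numbers_completion:
  fixes X :: "nat \<Rightarrow> 'a \<Rightarrow> 'b" and h :: "'b \<Rightarrow> real"
  assumes indep: "indep_vars (\<lambda>_. N) X {1..}"
    and distr: "\<And>i. i \<ge> 1 \<Longrightarrow> distr M N (X i) = \<mu>"
    and h: "integrable (completion \<mu>) h"
  shows "AE \<omega> in M. (\<lambda>n. 1 / real n * (\<Sum>i=1..n. h (X i \<omega>))) \<longlonglongrightarrow> (\<integral>y. h y \<partial>completion \<mu>)"
proof -
  have X: "X i \<in> measurable M N" if "i \<ge> 1" for i
    using indep that unfolding indep_vars_def by auto
  obtain g where g: "g \<in> borel_measurable \<mu>" "AE y in \<mu>. h y = g y"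
    using completion_ex_borel_measurable_real[of h \<mu>] h by blast
  have eq: "AE y in completion \<mu>. h y = g y" by (rule AE_completion[OF g(2)])
  have meas: "g \<in> borel_measurable (completion \<mu>)" by (rule measurable_completion[OF g(1)])
  have "integrable (completion \<mu>) g"
    using integrable_cong_AE_imp[OF h meas] eq by (simp add: eq_commute)
  then have "integrable \<mu> g" using integrable_completion[OF g(1)] by simp
  from strong_law_of_large_numbers_iid[OF indep _ this] distr
  have "AE \<omega> in M. (\<lambda>n. 1 / real n * (\<Sum>i=1..n. g (X i \<omega>))) \<longlonglongrightarrow> (\<integral>y. g y \<partial>\<mu>)"
    by blast
  moreover have "AE \<omega> in M. \<forall>i\<ge>1. h (X i \<omega>) = g (X i \<omega>)"
    by (rule AE_all_identically_distributed[OF _ _ g(2)]) (use X distr in auto)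
  ultimately show ?thesis
  proof eventually_elim
    case (elim \<omega>)
    have "(\<Sum>i=1..n. h (X i \<omega>)) = (\<Sum>i=1..n. g (X i \<omega>))" for n
      using elim(2) by (intro sum.cong) auto
    moreover have "(\<integral>y. h y \<partial>completion \<mu>) = (\<integral>y. g y \<partial>\<mu>)"
      using integral_cong_AE[OF borel_measurable_integrable[OF h] meas eq] integral_completion[OF g(1)] by simp
    ultimately show ?case using elim(1) by simp
  qed
qed

end

lemma lower_semicontinuousD:
  assumes "lower_semicontinuous f" "a < f x"
  obtains V where "open V" "x \<in> V" "\<And>z. z \<in> V \<Longrightarrow> a < f z"
proof -
  have "\<forall>\<^sub>F z in at x. ereal a < ereal (f z)"
    using assms unfolding lower_semicontinuous_def le_Liminf_iff by (metis less_ereal.simps(1))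
  then have "\<forall>\<^sub>F z in nhds x. a < f z"
    using assms(2) by (auto simp: eventually_at_filter elim: eventually_mono)
  then show ?thesis
    using that unfolding eventually_nhds by blast
qed

text \<open>
  The infimum is formed in \<^typ>\<open>ereal\<close>, where infima over uncountable sets are covered by
  measurable projection; where it is infinite, the value is \<open>0\<close>. For nonempty \<open>U\<close> this happens only
  where the supremum of \<open>\<bar>c y q\<bar>\<close> over \<open>U\<close> is infinite, in the applications a null set.
\<close>

definition local_inf :: "('y \<Rightarrow> 'q \<Rightarrow> real) \<Rightarrow> 'q set \<Rightarrow> 'y \<Rightarrow> real" where
  "local_inf c U y = real_of_ereal (INF q\<in>U. ereal (c y q))"

lemma local_inf_eq:
  assumes "q \<in> U" "U \<subseteq> B" and fin: "(SUP q\<in>B. ennreal \<bar>c y q\<bar>) < \<infinity>"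
  shows "ereal (local_inf c U y) = (INF q\<in>U. ereal (c y q))"
    and "\<bar>local_inf c U y\<bar> \<le> enn2real (SUP q\<in>B. ennreal \<bar>c y q\<bar>)"
proof -
  let ?h = "enn2real (SUP q\<in>B. ennreal \<bar>c y q\<bar>)" and ?I = "INF q\<in>U. ereal (c y q)"
  have bound: "\<bar>c y q\<bar> \<le> ?h" if "q \<in> U" for q
  proof -
    have "ennreal \<bar>c y q\<bar> \<le> (SUP q\<in>B. ennreal \<bar>c y q\<bar>)"
      using that assms(2) by (intro SUP_upper) auto
    then show ?thesis using fin by (metis abs_ge_zero enn2real_ennreal enn2real_mono infinity_ennreal_def)
  qed
  have "ereal (- ?h) \<le> ?I"
    using bound by (intro INF_greatest) (auto simp: abs_le_iff minus_le_iff)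
  moreover have "?I \<le> ereal (c y q)" using \<open>q \<in> U\<close> by (rule INF_lower)
  moreover have "c y q \<le> ?h" using bound[OF \<open>q \<in> U\<close>] by (simp add: abs_le_iff)
  ultimately show "ereal (local_inf c U y) = ?I" "\<bar>local_inf c U y\<bar> \<le> ?h"
    unfolding local_inf_def by (cases ?I; auto simp: abs_le_iff)+
qed

lemma local_inf_le:
  assumes "q \<in> U" "U \<subseteq> B" "(SUP q\<in>B. ennreal \<bar>c y q\<bar>) < \<infinity>"
  shows "local_inf c U y \<le> c y q"
proof -
  have "ereal (local_inf c U y) = (INF q\<in>U. ereal (c y q))"
    using assms by (rule local_inf_eq(1))
  also have "\<dots> \<le> ereal (c y q)" using assms(1) by (rule INF_lower)
  finally show ?thesis by simp
qed

text \<open>Lower semi-continuity bounds the infima from below, and \<open>q \<in> U k\<close> bounds them from above.\<close>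

lemma local_inf_tendsto:
  assumes lsc: "lower_semicontinuous (c y)"
    and U: "\<And>k. q \<in> U k" "\<And>k. U k \<subseteq> B" "\<And>V. open V \<Longrightarrow> q \<in> V \<Longrightarrow> \<forall>\<^sub>F k in sequentially. U k \<subseteq> V"
    and fin: "(SUP q\<in>B. ennreal \<bar>c y q\<bar>) < \<infinity>"
  shows "(\<lambda>k. local_inf c (U k) y) \<longlonglongrightarrow> c y q"
proof (rule order_tendstoI)
  fix a assume "a < c y q"
  then obtain b where b: "a < b" "b < c y q" using dense by blast
  obtain V where V: "open V" "q \<in> V" "\<And>z. z \<in> V \<Longrightarrow> b < c y z"
    using lower_semicontinuousD[OF lsc b(2)] by blast
  from U(3)[OF V(1,2)] show "\<forall>\<^sub>F k in sequentially. a < local_inf c (U k) y"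
  proof eventually_elim
    case (elim k)
    have "ereal b \<le> (INF z\<in>U k. ereal (c y z))"
      using elim V(3) by (intro INF_greatest) (auto intro: less_imp_le)
    also have "\<dots> = ereal (local_inf c (U k) y)"
      using local_inf_eq(1)[of q "U k" B c y] U(1,2) fin by auto
    finally show ?case using b(1) by simp
  qed
next
  fix a assume "c y q < a"
  moreover have "local_inf c (U k) y \<le> c y q" for k
    using U(1,2)[of k] fin by (rule local_inf_le)
  ultimately show "\<forall>\<^sub>F k in sequentially. local_inf c (U k) y < a"
    by (intro always_eventually allI) (rule le_less_trans)
qed

text \<open>The integrable function that dominates all local infima below is the supremum of \<open>\<bar>c y q\<bar>\<close> over \<open>B\<close>.\<close>

lemma integrable_local_inf:
  fixes c :: "'y \<Rightarrow> 'q::polish_space \<Rightarrow> real"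
  assumes fin: "finite_measure M" and c: "(\<lambda>(y, q). c y q) \<in> borel_measurable (M \<Otimes>\<^sub>M borel)"
    and B: "B \<in> sets borel" "(\<integral>\<^sup>+y. (SUP q\<in>B. ennreal \<bar>c y q\<bar>) \<partial>M) < \<infinity>"
  shows "AE y in M. (SUP q\<in>B. ennreal \<bar>c y q\<bar>) < \<infinity>"
    and "integrable (completion M) (\<lambda>y. enn2real (SUP q\<in>B. ennreal \<bar>c y q\<bar>))"
    and "U \<in> sets borel \<Longrightarrow> local_inf c U \<in> borel_measurable (completion M)"
    and "U \<in> sets borel \<Longrightarrow> q \<in> U \<Longrightarrow> U \<subseteq> B \<Longrightarrow> integrable (completion M) (local_inf c U)"
proof -
  define H where "H = (\<lambda>y. SUP q\<in>B. ennreal \<bar>c y q\<bar>)"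
  have "(\<lambda>(y, q). ennreal \<bar>c y q\<bar>) \<in> borel_measurable (M \<Otimes>\<^sub>M borel)"
    using c by (simp add: case_prod_unfold)
  then have H: "H \<in> borel_measurable (completion M)"
    unfolding H_def by (rule borel_measurable_SUP_completion[OF fin B(1)])
  have H_fin: "(\<integral>\<^sup>+y. H y \<partial>completion M) < \<infinity>"
    using B(2) by (simp only: nn_integral_completion H_def)
  have "AE y in completion M. H y \<noteq> \<infinity>"
    using H_fin by (intro nn_integral_PInf_AE[OF H]) simp
  then have AE: "AE y in completion M. H y < \<infinity>"
    by (simp add: less_top)
  then show "AE y in M. (SUP q\<in>B. ennreal \<bar>c y q\<bar>) < \<infinity>"
    by (simp only: AE_completion_iff H_def)
  have H_int: "integrable (completion M) (\<lambda>y. enn2real (H y))"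
  proof (rule integrableI_bounded)
    have "(\<integral>\<^sup>+y. ennreal (norm (enn2real (H y))) \<partial>completion M) = (\<integral>\<^sup>+y. H y \<partial>completion M)"
      by (intro nn_integral_cong_AE) (use AE in \<open>auto elim!: eventually_mono\<close>)
    then show "(\<integral>\<^sup>+y. ennreal (norm (enn2real (H y))) \<partial>completion M) < \<infinity>" using H_fin by simp
  qed (use H in simp)
  then show "integrable (completion M) (\<lambda>y. enn2real (SUP q\<in>B. ennreal \<bar>c y q\<bar>))"
    by (simp only: H_def)
  show meas: "local_inf c U \<in> borel_measurable (completion M)" if "U \<in> sets borel" for U
  proof -
    have "(\<lambda>(y, q). ereal (c y q)) \<in> borel_measurable (M \<Otimes>\<^sub>M borel)"
      using c by (simp add: case_prod_unfold)
    then show ?thesis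
      unfolding local_inf_def[abs_def]
      by (intro borel_measurable_real_of_ereal borel_measurable_INF_completion[OF fin that])
  qed
  show "integrable (completion M) (local_inf c U)" if "U \<in> sets borel" "q \<in> U" "U \<subseteq> B" for U q
  proof (rule Bochner_Integration.integrable_bound[OF H_int meas[OF that(1)]])
    show "AE y in completion M. norm (local_inf c U y) \<le> norm (enn2real (H y))"
      using AE
    proof eventually_elim
      case (elim y)
      then show ?case
        using local_inf_eq(2)[OF that(2,3), of c y] by (simp add: H_def)
    qed
  qed
qed

lemma integral_local_inf_tendsto:
  fixes c :: "'y \<Rightarrow> 'q::polish_space \<Rightarrow> real"
  assumes fin: "finite_measure M" and c: "(\<lambda>(y, q). c y q) \<in> borel_measurable (M \<Otimes>\<^sub>M borel)"
    and lsc: "\<And>y. y \<in> space M \<Longrightarrow> lower_semicontinuous (c y)"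
    and B: "B \<in> sets borel" "(\<integral>\<^sup>+y. (SUP q\<in>B. ennreal \<bar>c y q\<bar>) \<partial>M) < \<infinity>"
    and U: "\<And>k. U k \<in> sets borel" "\<And>k. q \<in> U k" "\<And>k. U k \<subseteq> B"
      "\<And>V. open V \<Longrightarrow> q \<in> V \<Longrightarrow> \<forall>\<^sub>F k in sequentially. U k \<subseteq> V"
  shows "(\<lambda>k. \<integral>y. local_inf c (U k) y \<partial>completion M) \<longlonglongrightarrow> (\<integral>y. c y q \<partial>M)"
proof -
  have c_q: "(\<lambda>y. c y q) \<in> borel_measurable M"
    using measurable_compose[OF _ c, of "\<lambda>y. (y, q)"] by simp
  have AE: "AE y in completion M. (SUP q\<in>B. ennreal \<bar>c y q\<bar>) < \<infinity>"
    by (rule AE_completion[OF integrable_local_inf(1)[OF fin c B]])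
  have "(\<lambda>k. \<integral>y. local_inf c (U k) y \<partial>completion M) \<longlonglongrightarrow> (\<integral>y. c y q \<partial>completion M)"
  proof (rule integral_dominated_convergence)
    show "integrable (completion M) (\<lambda>y. enn2real (SUP q\<in>B. ennreal \<bar>c y q\<bar>))"
      by (rule integrable_local_inf(2)[OF fin c B])
    show "AE y in completion M. (\<lambda>k. local_inf c (U k) y) \<longlonglongrightarrow> c y q"
      using AE AE_space
    proof eventually_elim
      case (elim y)
      then show ?case using U(2-4) lsc by (intro local_inf_tendsto) auto
    qed
    show "AE y in completion M. norm (local_inf c (U k) y) \<le> enn2real (SUP q\<in>B. ennreal \<bar>c y q\<bar>)" for k
      using AE
    proof eventually_elim
      case (elim y)
      then show ?case using local_inf_eq(2)[of q "U k" B c y] U(2,3) by auto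
    qed
  qed (use integrable_local_inf(3)[OF fin c B U(1)] measurable_completion[OF c_q] in auto)
  then show ?thesis by (simp add: integral_completion[OF c_q])
qed

text \<open>
  This is the liminf half of epi-convergence, with one null set for all \<open>q\<close> at once. For a ball \<open>U\<close>, the empirical
  cost on \<open>U\<close> is at least the average of the local infima over \<open>U\<close>, to which the law of large numbers
  applies. Countably many balls, centred at a dense sequence, are enough: those that contain \<open>q\<close> can be
  taken arbitrarily small, and then the mean of the local infimum is close to the mean cost at \<open>q\<close>.
\<close>

lemma (in prob_space) AE_empirical_cost_lower:
  fixes c :: "'y \<Rightarrow> 'q::polish_space \<Rightarrow> real"
  assumes indep: "indep_vars (\<lambda>_. S) X {1..}" and distr: "\<And>i. i \<ge> 1 \<Longrightarrow> distr M S (X i) = \<mu>"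
    and c: "(\<lambda>(y, q). c y q) \<in> borel_measurable (\<mu> \<Otimes>\<^sub>M borel)"
    and lsc: "\<And>y. y \<in> space \<mu> \<Longrightarrow> lower_semicontinuous (c y)"
    and fin: "\<And>B. B \<in> sets borel \<Longrightarrow> bounded B \<Longrightarrow> (\<integral>\<^sup>+y. (SUP q\<in>B. ennreal \<bar>c y q\<bar>) \<partial>\<mu>) < \<infinity>"
  shows "AE \<omega> in M. \<forall>q a. a < (\<integral>y. c y q \<partial>\<mu>) \<longrightarrow>
    (\<exists>U. open U \<and> q \<in> U \<and> (\<forall>\<^sub>F n in sequentially. \<forall>p\<in>U. a \<le> empirical_cost c X n \<omega> p))"
proof -
  have X: "X i \<in> measurable M S" if "i \<ge> 1" for i
    using indep that unfolding indep_vars_def by auto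
  have "prob_space (distr M S (X 1))"
    by (intro prob_space_distr X) simp
  then have "prob_space \<mu>" using distr[of 1] by simp
  then have fin_\<mu>: "finite_measure \<mu>" by (simp add: prob_space_def)
  obtain d :: "nat \<Rightarrow> 'q" where d: "\<And>U. open U \<Longrightarrow> U \<noteq> {} \<Longrightarrow> \<exists>n. d n \<in> U"
    using dense_sequence by blast
  define V where "V i k = ball (d i) (inverse (real (Suc k)))" for i k
  have V: "V i k \<in> sets borel" "bounded (V i k)" "d i \<in> V i k" "open (V i k)" for i k
    by (auto simp: V_def)
  have "AE \<omega> in M. (\<lambda>n. 1 / real n * (\<Sum>j=1..n. local_inf c (V i k) (X j \<omega>)))
      \<longlonglongrightarrow> (\<integral>y. local_inf c (V i k) y \<partial>completion \<mu>)" for i k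
    by (rule strong_law_of_large_numbers_completion[OF indep])
      (use distr integrable_local_inf(4)[OF fin_\<mu> c V(1) fin[OF V(1,2)] V(1,3) order_refl] in auto)
  then have "AE \<omega> in M. \<forall>i k. (\<lambda>n. 1 / real n * (\<Sum>j=1..n. local_inf c (V i k) (X j \<omega>)))
      \<longlonglongrightarrow> (\<integral>y. local_inf c (V i k) y \<partial>completion \<mu>)"
    by (simp add: AE_all_countable)
  moreover have "AE y in \<mu>. \<forall>i k. (SUP q\<in>V i k. ennreal \<bar>c y q\<bar>) < \<infinity>"
    unfolding AE_all_countable by (intro allI integrable_local_inf(1)[OF fin_\<mu> c V(1) fin[OF V(1,2)]])
  then have "AE \<omega> in M. \<forall>j\<ge>1. \<forall>i k. (SUP q\<in>V i k. ennreal \<bar>c (X j \<omega>) q\<bar>) < \<infinity>"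
    by (intro AE_all_identically_distributed[of X S \<mu>]) (use X distr in auto)
  ultimately show ?thesis
  proof eventually_elim
    case (elim \<omega>)
    note fin_AE = elim(2)
    show ?case
    proof (intro allI impI)
      fix q a assume a: "a < (\<integral>y. c y q \<partial>\<mu>)"
      have "\<exists>i. q \<in> V i k" for k
        using d[of "ball q (inverse (real (Suc k)))"] unfolding V_def
        by (auto simp: dist_commute)
      then obtain i where i: "\<And>k. q \<in> V (i k) k" by metis
      have small: "V (i k) k \<subseteq> ball q (2 * inverse (real (Suc k)))" for k
      proof
        fix p assume "p \<in> V (i k) k"
        then show "p \<in> ball q (2 * inverse (real (Suc k)))"
          using i[of k] dist_triangle[of q p "d (i k)"] by (simp add: V_def dist_commute)
      qed
      have "(\<lambda>k. \<integral>y. local_inf c (V (i k) k) y \<partial>completion \<mu>) \<longlonglongrightarrow> (\<integral>y. c y q \<partial>\<mu>)"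
      proof (rule integral_local_inf_tendsto[OF fin_\<mu> c lsc, of "ball q 2"])
        show "V (i k) k \<subseteq> ball q 2" for k
        proof -
          have "2 * inverse (real (Suc k)) \<le> 2" by (simp add: field_simps)
          then show ?thesis using small[of k] by (meson order_trans subset_ball)
        qed
        fix W assume "open W" "q \<in> W"
        then obtain e where e: "e > 0" "ball q e \<subseteq> W" by (auto simp: open_contains_ball)
        have "(\<lambda>k. 2 * inverse (real (Suc k))) \<longlonglongrightarrow> 2 * 0"
          by (intro tendsto_mult tendsto_const LIMSEQ_inverse_real_of_nat)
        then have "\<forall>\<^sub>F k in sequentially. 2 * inverse (real (Suc k)) < e"
          using e(1) by (intro order_tendstoD(2)) auto
        then show "\<forall>\<^sub>F k in sequentially. V (i k) k \<subseteq> W"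
        proof eventually_elim
          case (elim k)
          then have "ball q (2 * inverse (real (Suc k))) \<subseteq> ball q e" by (intro subset_ball) simp
          then show ?case using small[of k] e(2) by (meson order_trans)
        qed
      qed (use fin V(1) i in auto)
      then have "\<forall>\<^sub>F k in sequentially. a < (\<integral>y. local_inf c (V (i k) k) y \<partial>completion \<mu>)"
        using a by (rule order_tendstoD(1))
      then obtain k where k: "a < (\<integral>y. local_inf c (V (i k) k) y \<partial>completion \<mu>)"
        by (auto simp: eventually_sequentially)
      let ?U = "V (i k) k"
      have "\<forall>\<^sub>F n in sequentially. a < 1 / real n * (\<Sum>j=1..n. local_inf c ?U (X j \<omega>))"
        using elim(1) k by (intro order_tendstoD(1)) auto
      then have "\<forall>\<^sub>F n in sequentially. \<forall>p\<in>?U. a \<le> empirical_cost c X n \<omega> p"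
      proof eventually_elim
        case (elim n)
        show ?case
        proof
          fix p assume "p \<in> ?U"
          have "local_inf c ?U (X j \<omega>) \<le> c (X j \<omega>) p" if "j \<ge> 1" for j
            using \<open>p \<in> ?U\<close> order_refl by (rule local_inf_le) (use fin_AE that in blast)
          then have "(\<Sum>j=1..n. local_inf c ?U (X j \<omega>)) \<le> (\<Sum>j=1..n. c (X j \<omega>) p)"
            by (intro sum_mono) auto
          then have "1 / real n * (\<Sum>j=1..n. local_inf c ?U (X j \<omega>)) \<le> empirical_cost c X n \<omega> p"
            unfolding empirical_cost_def by (intro mult_left_mono) auto
          then show "a \<le> empirical_cost c X n \<omega> p" using elim by linarith
        qed
      qed
      then show "\<exists>U. open U \<and> q \<in> U \<and> (\<forall>\<^sub>F n in sequentially. \<forall>p\<in>U. a \<le> empirical_cost c X n \<omega> p)"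
        using V(4) i by blast
    qed
  qed
qed

section \<open>Convergence of approximate minimizers\<close>

text \<open>
  Either the range has a limit point, which is the limit of a subsequence, or it is closed, hence compact.
  Only subsets of the range need to be compact; the limit may lie outside.
\<close>

lemma convergent_subsequence_if_closed_bounded_compact:
  fixes x :: "nat \<Rightarrow> 'a::metric_space"
  assumes bdd: "bounded (range x)"
    and compact: "\<And>K. K \<subseteq> range x \<Longrightarrow> closed K \<Longrightarrow> bounded K \<Longrightarrow> compact K"
  shows "\<exists>l r. strict_mono r \<and> (x \<circ> r) \<longlonglongrightarrow> l"
proof (cases "\<exists>l. l islimpt range x")
  case True
  then show ?thesis using islimpt_range_imp_convergent_subsequence by blast
next
  case False
  then have "closed (range x)" by (simp add: closed_limpt)
  then have "seq_compact (range x)" using compact bdd by (simp add: compact_imp_seq_compact)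
  then show ?thesis by (rule seq_compactE[of _ x]) auto
qed

lemma eps_argmin_set_le: "q \<in> eps_argmin_set \<epsilon> f \<Longrightarrow> f q \<le> \<epsilon> + f p"
proof -
  assume "q \<in> eps_argmin_set \<epsilon> f"
  then have "ereal (f q) \<le> ereal \<epsilon> + (INF q'. ereal (f q'))" by (simp add: eps_argmin_set_def)
  also have "\<dots> \<le> ereal \<epsilon> + ereal (f p)" by (intro add_left_mono INF_lower) simp
  finally show ?thesis by simp
qed

lemma argmin_setI: "(\<And>p. f q \<le> f p) \<Longrightarrow> q \<in> argmin_set f"
  unfolding argmin_set_def by (auto intro!: antisym INF_greatest INF_lower)

text \<open>
  If the distances do not tend to \<open>0\<close>, there are approximate minimizers \<open>x k\<close> of \<open>f (r k)\<close>, for a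
  subsequence \<open>r\<close>, that stay away from the minimizers of \<open>F\<close>. They are bounded, so that a further
  subsequence converges, to \<open>l\<close> say. Were \<open>F q < F l\<close> for some \<open>q\<close>, the values of \<open>f (r k)\<close> near \<open>l\<close> would
  eventually exceed some value of \<open>f (r k)\<close> by a fixed amount, which contradicts near-minimality. So \<open>l\<close> minimizes
  \<open>F\<close>, although the \<open>x k\<close> approach it. If \<open>F\<close> has no minimizer, the argument shows that the approximate
  minimizers eventually cease to exist.
\<close>

lemma one_sided_hausdorff_eps_argmin_tendsto:
  fixes f :: "nat \<Rightarrow> 'a::metric_space \<Rightarrow> real" and F :: "'a \<Rightarrow> real"
  assumes eps: "\<epsilon> \<longlonglongrightarrow> 0"
    and lower: "\<And>q a. a < F q \<Longrightarrow> \<exists>U. open U \<and> q \<in> U \<and> (\<forall>\<^sub>F n in sequentially. \<forall>p\<in>U. a \<le> f n p)"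
    and upper: "\<And>q a. F q < a \<Longrightarrow> \<exists>p. \<forall>\<^sub>F n in sequentially. f n p < a"
    and bdd: "\<forall>\<^sub>F n in sequentially. eps_argmin_set (\<epsilon> n) (f n) \<subseteq> B" "bounded B"
    and compact: "\<And>K. K \<subseteq> (\<Union>n\<in>{N0..}. eps_argmin_set (\<epsilon> n) (f n)) \<Longrightarrow> closed K \<Longrightarrow> bounded K
        \<Longrightarrow> compact K"
  shows "(\<lambda>n. one_sided_hausdorff (eps_argmin_set (\<epsilon> n) (f n)) (argmin_set F)) \<longlonglongrightarrow> 0"
proof (rule order_tendstoI)
  fix e :: ennreal assume "0 < e"
  let ?h = "\<lambda>n. one_sided_hausdorff (eps_argmin_set (\<epsilon> n) (f n)) (argmin_set F)"
  obtain e' where e': "0 < e'" "e' < e" using dense[OF \<open>0 < e\<close>] by blast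
  show "\<forall>\<^sub>F n in sequentially. ?h n < e"
  proof (rule ccontr)
    assume "\<not> ?thesis"
    then have "\<exists>\<^sub>F n in sequentially. e \<le> ?h n"
      by (simp add: not_eventually not_less)
    then have "\<exists>\<^sub>F n in sequentially. e \<le> ?h n \<and> eps_argmin_set (\<epsilon> n) (f n) \<subseteq> B \<and> N0 \<le> n"
      by (rule frequently_rev_mp) (use bdd(1) eventually_ge_at_top[of N0] in \<open>eventually_elim; simp\<close>)
    then have "infinite {n. e \<le> ?h n \<and> eps_argmin_set (\<epsilon> n) (f n) \<subseteq> B \<and> N0 \<le> n}"
      by (simp add: cofinite_eq_sequentially[symmetric] frequently_cofinite)
    from infinite_enumerate[OF this] obtain r :: "nat \<Rightarrow> nat" where "strict_mono r"
      "\<forall>k. r k \<in> {n. e \<le> ?h n \<and> eps_argmin_set (\<epsilon> n) (f n) \<subseteq> B \<and> N0 \<le> n}"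
      by blast
    then have r: "strict_mono r" "\<And>k. e \<le> ?h (r k)"
      "\<And>k. eps_argmin_set (\<epsilon> (r k)) (f (r k)) \<subseteq> B" "\<And>k. N0 \<le> r k"
      by simp_all
    have "\<exists>x\<in>eps_argmin_set (\<epsilon> (r k)) (f (r k)). e' < (INF x'\<in>argmin_set F. ennreal (dist x x'))" for k
      using less_le_trans[OF e'(2) r(2)[of k]] unfolding one_sided_hausdorff_def by (simp add: less_SUP_iff)
    then obtain x where x: "\<And>k. x k \<in> eps_argmin_set (\<epsilon> (r k)) (f (r k))"
      "\<And>k. e' < (INF x'\<in>argmin_set F. ennreal (dist (x k) x'))"
      by metis
    have "\<exists>l s. strict_mono s \<and> (x \<circ> s) \<longlonglongrightarrow> l"
    proof (rule convergent_subsequence_if_closed_bounded_compact)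
      have "range x \<subseteq> B" using x(1) r(3) by blast
      then show "bounded (range x)" using bdd(2) bounded_subset by blast
      fix K assume K: "K \<subseteq> range x" "closed K" "bounded K"
      have "range x \<subseteq> (\<Union>n\<in>{N0..}. eps_argmin_set (\<epsilon> n) (f n))"
        using x(1) r(4) by blast
      then show "compact K" by (rule compact[OF order_trans[OF K(1)] K(2,3)])
    qed
    then obtain l s where s: "strict_mono s" and lim: "(x \<circ> s) \<longlonglongrightarrow> l" by blast
    have sub: "filterlim (r \<circ> s) sequentially sequentially"
      by (intro filterlim_subseq strict_mono_o r s)
    have "l \<in> argmin_set F"
    proof (rule argmin_setI, rule ccontr)
      fix q assume "\<not> F l \<le> F q"
      then obtain b where b: "F q < b" "b < F l" using dense[of "F q" "F l"] by auto
      then obtain a where a: "F q < a" "a < b" using dense by blast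
      obtain U where U: "open U" "l \<in> U" "\<forall>\<^sub>F n in sequentially. \<forall>p\<in>U. b \<le> f n p"
        using lower[OF b(2)] by blast
      obtain p where p: "\<forall>\<^sub>F n in sequentially. f n p < a"
        using upper[OF a(1)] by blast
      have small: "\<forall>\<^sub>F n in sequentially. \<epsilon> n < b - a"
        using order_tendstoD(2)[OF eps, of "b - a"] a(2) by simp
      have "\<forall>\<^sub>F k in sequentially. (x \<circ> s) k \<in> U"
        using topological_tendstoD[OF lim U(1,2)] .
      moreover have "\<forall>\<^sub>F k in sequentially. \<forall>p\<in>U. b \<le> f ((r \<circ> s) k) p"
        by (rule eventually_compose_filterlim[OF U(3) sub])
      moreover have "\<forall>\<^sub>F k in sequentially. f ((r \<circ> s) k) p < a"
        by (rule eventually_compose_filterlim[OF p sub])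
      moreover have "\<forall>\<^sub>F k in sequentially. \<epsilon> ((r \<circ> s) k) < b - a"
        by (rule eventually_compose_filterlim[OF small sub])
      ultimately have "\<forall>\<^sub>F k in sequentially. False"
      proof eventually_elim
        case (elim k)
        have "b \<le> f (r (s k)) (x (s k))" using elim by simp
        also have "\<dots> \<le> \<epsilon> (r (s k)) + f (r (s k)) p" by (rule eps_argmin_set_le[OF x(1)])
        also have "\<dots> < b" using elim by simp
        finally show False by simp
      qed
      then show False by simp
    qed
    have "e' \<le> ennreal (dist ((x \<circ> s) k) l)" for k
    proof -
      have "e' < (INF x'\<in>argmin_set F. ennreal (dist (x (s k)) x'))" by (rule x(2))
      also have "\<dots> \<le> ennreal (dist (x (s k)) l)" by (rule INF_lower[OF \<open>l \<in> argmin_set F\<close>])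
      finally show ?thesis unfolding o_apply by (rule less_imp_le)
    qed
    moreover have "(\<lambda>k. ennreal (dist ((x \<circ> s) k) l)) \<longlonglongrightarrow> ennreal 0"
    proof (rule tendsto_ennrealI)
      show "(\<lambda>k. dist ((x \<circ> s) k) l) \<longlonglongrightarrow> 0"
        using lim by (rule tendsto_dist_iff[THEN iffD1])
    qed
    ultimately have "e' \<le> ennreal 0"
      by (intro LIMSEQ_le_const) auto
    then show False using e'(1) by simp
  qed
qed simp

text \<open>
  Far from \<open>o'\<close> the term with \<open>\<phi>\<close> outweighs the one with \<open>\<psi>\<close>, uniformly in large \<open>n\<close>, and pushes \<open>f n\<close> above
  the value \<open>f n o'\<close>, which stays bounded.
\<close>

lemma eps_argmin_set_eventually_bounded:
  fixes f :: "nat \<Rightarrow> 'a::metric_space \<Rightarrow> real"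
  assumes eps: "\<epsilon> \<longlonglongrightarrow> 0"
    and a: "a \<longlonglongrightarrow> a'" "b \<longlonglongrightarrow> b'" "a' > 0"
    and b_nonneg: "\<And>n. n \<ge> 1 \<Longrightarrow> b n \<ge> 0"
    and nonneg: "\<And>\<delta>. \<delta> \<ge> 0 \<Longrightarrow> \<phi> \<delta> \<ge> 0" "\<And>\<delta>. \<delta> \<ge> 0 \<Longrightarrow> \<psi> \<delta> \<ge> 0"
    and growth: "filterlim (\<lambda>\<delta>. \<phi> \<delta> / max 1 (\<psi> \<delta>)) at_top at_top"
    and lower: "\<And>n q. n \<ge> 1 \<Longrightarrow> a n * \<phi> (dist q o') - b n * \<psi> (dist q o') \<le> f n q"
    and conv: "(\<lambda>n. f n o') \<longlonglongrightarrow> F"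
  shows "\<exists>R. \<forall>\<^sub>F n in sequentially. eps_argmin_set (\<epsilon> n) (f n) \<subseteq> cball o' R"
proof -
  \<comment> \<open>With \<open>a n \<ge> a' / 2\<close> and \<open>b n \<le> b' + 1\<close>, a ratio above \<open>K\<close> makes the lower bound at least \<open>\<bar>F\<bar> + 2\<close>,
      whereas \<open>\<epsilon> n + f n o'\<close> is below \<open>\<bar>F\<bar> + 1\<close>.\<close>
  define K where "K = (b' + 1 + \<bar>F\<bar> + 2) / (a' / 2)"
  have "\<forall>\<^sub>F \<delta> in at_top. K < \<phi> \<delta> / max 1 (\<psi> \<delta>)"
    using growth by (simp add: filterlim_at_top_dense)
  then obtain R where R: "\<And>\<delta>. \<delta> \<ge> R \<Longrightarrow> K < \<phi> \<delta> / max 1 (\<psi> \<delta>)"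
    by (auto simp: eventually_at_top_linorder)
  have "\<forall>\<^sub>F n in sequentially. a' / 2 < a n"
    by (rule order_tendstoD(1)[OF a(1)]) (use a(3) in simp)
  moreover have "\<forall>\<^sub>F n in sequentially. b n < b' + 1"
    by (rule order_tendstoD(2)[OF a(2)]) simp
  moreover have "\<forall>\<^sub>F n in sequentially. \<epsilon> n + f n o' < \<bar>F\<bar> + 1"
    by (rule order_tendstoD(2)[OF tendsto_add[OF eps conv]]) simp
  ultimately have "\<forall>\<^sub>F n in sequentially. eps_argmin_set (\<epsilon> n) (f n) \<subseteq> cball o' R"
    using eventually_ge_at_top[of 1]
  proof eventually_elim
    case (elim n)
    show ?case
    proof
      fix q assume q: "q \<in> eps_argmin_set (\<epsilon> n) (f n)"
      show "q \<in> cball o' R"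
      proof (rule ccontr)
        let ?d = "dist q o'" and ?m = "max 1 (\<psi> (dist q o'))"
        assume "q \<notin> cball o' R"
        then have "K < \<phi> ?d / ?m" by (intro R) (simp add: dist_commute)
        then have "K * ?m \<le> \<phi> ?d" by (simp add: pos_less_divide_eq less_imp_le)
        then have "(a' / 2) * (K * ?m) \<le> (a' / 2) * \<phi> ?d"
          using a(3) by (intro mult_left_mono) auto
        also have "\<dots> \<le> a n * \<phi> ?d"
          using elim(1) nonneg(1)[of ?d] by (intro mult_right_mono) auto
        finally have "(a' / 2) * (K * ?m) \<le> a n * \<phi> ?d" .
        moreover have "(a' / 2) * (K * ?m) = (b' + 1 + \<bar>F\<bar> + 2) * ?m"
          using a(3) by (simp add: K_def)
        moreover have "b n * \<psi> ?d \<le> (b' + 1) * ?m"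
          using elim(2,4) b_nonneg[of n] nonneg(2)[of ?d] by (intro mult_mono) auto
        ultimately have "(\<bar>F\<bar> + 2) * ?m \<le> a n * \<phi> ?d - b n * \<psi> ?d"
          by (simp add: algebra_simps)
        moreover have "(\<bar>F\<bar> + 2) * 1 \<le> (\<bar>F\<bar> + 2) * ?m"
          by (intro mult_left_mono) auto
        moreover have "a n * \<phi> ?d - b n * \<psi> ?d \<le> f n q" using lower elim(4) by blast
        ultimately show False
          using eps_argmin_set_le[OF q, of o'] elim(3) by simp
      qed
    qed
  qed
  then show ?thesis by blast
qed

section \<open>Almost sure convergence of empirical minimizers\<close>

theorem theorem3p5:
  fixes P :: "'w measure"
    and S :: "'y measure"
    and c :: "'y \<Rightarrow> 'q::polish_space \<Rightarrow> real"
    and Y :: "'w \<Rightarrow> 'y"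
    and Ys :: "nat \<Rightarrow> 'w \<Rightarrow> 'y"
    and \<epsilon> :: "nat \<Rightarrow> real"
    and q0 :: 'q
    and \<psi>p \<psi>m :: "real \<Rightarrow> real"
    and ap am :: real
    and apn amn :: "nat \<Rightarrow> 'w \<Rightarrow> real"
  assumes prob: "prob_space P"
    and c_meas: "(\<lambda>(y, q). c y q) \<in> borel_measurable (S \<Otimes>\<^sub>M borel)"
    and Y_rv: "Y \<in> measurable P S"
    and Ys_indep: "prob_space.indep_vars P (\<lambda>_. S) Ys {1..}"
    and Ys_distr: "\<And>i. i \<ge> 1 \<Longrightarrow> distr P S (Ys i) = distr P S Y"
    and eps_nonneg: "\<And>n. n \<ge> 1 \<Longrightarrow> \<epsilon> n \<ge> 0"
    and eps_tendsto: "\<epsilon> \<longlonglongrightarrow> 0"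
    and c_lsc: "\<And>y. y \<in> space S \<Longrightarrow> lower_semicontinuous (c y)"
    and inf_bound: "ereal_expectation P (\<lambda>\<omega>. INF q. ereal (c (Y \<omega>) q)) > -\<infinity>"
    and heine_borel: "AE \<omega> in P. \<exists>N0\<ge>1. \<forall>K.
          K \<subseteq> (\<Union>n\<in>{N0..}. eps_argmin_set (\<epsilon> n) (empirical_cost c Ys n \<omega>)) \<and> closed K \<and> bounded K
          \<longrightarrow> compact K"
    and sup_bound: "\<And>B. bounded B \<Longrightarrow>
          (\<integral>\<^sup>+\<omega>. (SUP q\<in>B. ennreal \<bar>c (Y \<omega>) q\<bar>) \<partial>completion P) < \<infinity>"
    and psi_nonneg: "\<And>\<delta>. \<delta> \<ge> 0 \<Longrightarrow> \<psi>p \<delta> \<ge> 0" "\<And>\<delta>. \<delta> \<ge> 0 \<Longrightarrow> \<psi>m \<delta> \<ge> 0"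
    and a_pos: "ap > 0" "am > 0"
    and an_meas: "\<And>n. n \<ge> 1 \<Longrightarrow> apn n \<in> borel_measurable (generated_sigma P S Ys n)"
                 "\<And>n. n \<ge> 1 \<Longrightarrow> amn n \<in> borel_measurable (generated_sigma P S Ys n)"
    and an_nonneg: "\<And>n \<omega>. n \<ge> 1 \<Longrightarrow> \<omega> \<in> space P \<Longrightarrow> apn n \<omega> \<ge> 0"
                   "\<And>n \<omega>. n \<ge> 1 \<Longrightarrow> \<omega> \<in> space P \<Longrightarrow> amn n \<omega> \<ge> 0"
    and lower_mean: "\<And>q. ap * \<psi>p (dist q q0) - am * \<psi>m (dist q q0) \<le> mean_cost P c Y q"
    and lower_empirical: "\<And>n \<omega> q. n \<ge> 1 \<Longrightarrow> \<omega> \<in> space P \<Longrightarrow>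
          apn n \<omega> * \<psi>p (dist q q0) - amn n \<omega> * \<psi>m (dist q q0) \<le> empirical_cost c Ys n \<omega> q"
    and an_tendsto: "AE \<omega> in P. (\<lambda>n. apn n \<omega>) \<longlonglongrightarrow> ap"
                    "AE \<omega> in P. (\<lambda>n. amn n \<omega>) \<longlonglongrightarrow> am"
    and psi_growth: "filterlim (\<lambda>\<delta>. \<psi>p \<delta> / max 1 (\<psi>m \<delta>)) at_top at_top"
  shows "AE \<omega> in P.
           (\<lambda>n. one_sided_hausdorff
                  (eps_argmin_set (\<epsilon> n) (empirical_cost c Ys n \<omega>))
                  (argmin_set (mean_cost P c Y))) \<longlonglongrightarrow> 0"
proof -
  interpret prob_space P by fact
  define \<mu> where "\<mu> = distr P S Y"
  have sets_\<mu>: "sets \<mu> = sets S" and space_\<mu>: "space \<mu> = space S" by (simp_all add: \<mu>_def)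
  have "prob_space \<mu>" unfolding \<mu>_def by (rule prob_space_distr[OF Y_rv])
  then have fin_\<mu>: "finite_measure \<mu>" by (simp add: prob_space_def)
  have distr: "distr P S (Ys i) = \<mu>" if "i \<ge> 1" for i
    using Ys_distr[OF that] by (simp add: \<mu>_def)
  have "sets (\<mu> \<Otimes>\<^sub>M (borel :: 'q measure)) = sets (S \<Otimes>\<^sub>M borel)"
    by (intro sets_pair_measure_cong sets_\<mu> refl)
  from measurable_cong_sets[OF this refl] c_meas
  have c: "(\<lambda>(y, q). c y q) \<in> borel_measurable (\<mu> \<Otimes>\<^sub>M borel)"
    by blast
  have c_q: "(\<lambda>y. c y q) \<in> borel_measurable \<mu>" for q
    using measurable_compose[OF _ c, of "\<lambda>y. (y, q)"] by simp
  have sup_fin: "(\<integral>\<^sup>+y. (SUP q\<in>B. ennreal \<bar>c y q\<bar>) \<partial>\<mu>) < \<infinity>" if "B \<in> sets borel" "bounded B" for B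
  proof -
    have "(\<lambda>(y, q). ennreal \<bar>c y q\<bar>) \<in> borel_measurable (\<mu> \<Otimes>\<^sub>M borel)"
      using c by (simp add: case_prod_unfold)
    then have "(\<lambda>y. SUP q\<in>B. ennreal \<bar>c y q\<bar>) \<in> borel_measurable (completion \<mu>)"
      by (rule borel_measurable_SUP_completion[OF fin_\<mu> that(1)])
    from nn_integral_completion_distr[OF Y_rv this[unfolded \<mu>_def]] sup_bound[OF that(2)]
    show ?thesis by (simp only: \<mu>_def)
  qed
  have mean: "mean_cost P c Y q = (\<integral>y. c y q \<partial>\<mu>)" for q
    unfolding mean_cost_def \<mu>_def using c_q[of q] Y_rv
    by (subst integral_distr) (auto simp: \<mu>_def)
  have integrable: "integrable \<mu> (\<lambda>y. c y q)" for q
  proof (rule integrableI_bounded[OF c_q])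
    show "(\<integral>\<^sup>+y. ennreal (norm (c y q)) \<partial>\<mu>) < \<infinity>"
      using sup_fin[of "{q}"] by simp
  qed
  have slln: "AE \<omega> in P. (\<lambda>n. empirical_cost c Ys n \<omega> q) \<longlonglongrightarrow> mean_cost P c Y q" for q
    unfolding empirical_cost_def mean
    by (rule strong_law_of_large_numbers_iid[OF Ys_indep distr integrable])
  \<comment> \<open>Countably many points whose mean costs approach the infimum: for every rational number above the
      infimum, one point with a smaller mean cost. For the other rational numbers, \<open>D r\<close> is arbitrary.\<close>
  define D :: "rat \<Rightarrow> 'q" where "D r = (SOME q. mean_cost P c Y q < of_rat r)" for r
  have "AE \<omega> in P. \<forall>r. (\<lambda>n. empirical_cost c Ys n \<omega> (D r)) \<longlonglongrightarrow> mean_cost P c Y (D r)"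
    unfolding AE_all_countable using slln by blast
  moreover have "AE \<omega> in P. \<forall>q a. a < mean_cost P c Y q \<longrightarrow>
      (\<exists>U. open U \<and> q \<in> U \<and> (\<forall>\<^sub>F n in sequentially. \<forall>p\<in>U. a \<le> empirical_cost c Ys n \<omega> p))"
    unfolding mean
    by (rule AE_empirical_cost_lower[OF Ys_indep distr c _ sup_fin]) (use c_lsc space_\<mu> in auto)
  ultimately show ?thesis
    using slln[of q0] heine_borel an_tendsto AE_space
  proof eventually_elim
    case (elim \<omega>)
    obtain N0 where N0: "\<And>K. K \<subseteq> (\<Union>n\<in>{N0..}. eps_argmin_set (\<epsilon> n) (empirical_cost c Ys n \<omega>)) \<Longrightarrow>
        closed K \<Longrightarrow> bounded K \<Longrightarrow> compact K"
      using elim(4) by blast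
    have "\<exists>R. \<forall>\<^sub>F n in sequentially. eps_argmin_set (\<epsilon> n) (empirical_cost c Ys n \<omega>) \<subseteq> cball q0 R"
    proof (rule eps_argmin_set_eventually_bounded[where f = "\<lambda>n. empirical_cost c Ys n \<omega>"])
      show "0 \<le> amn n \<omega>" if "1 \<le> n" for n
        using an_nonneg(2)[OF that elim(7)] .
      show "apn n \<omega> * \<psi>p (dist q q0) - amn n \<omega> * \<psi>m (dist q q0) \<le> empirical_cost c Ys n \<omega> q"
        if "1 \<le> n" for n q
        using lower_empirical[OF that elim(7)] .
    qed (fact eps_tendsto elim(3,5,6) a_pos(1) psi_nonneg psi_growth)+
    then obtain R where R: "\<forall>\<^sub>F n in sequentially. eps_argmin_set (\<epsilon> n) (empirical_cost c Ys n \<omega>) \<subseteq> cball q0 R"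
      by blast
    show ?case
    proof (rule one_sided_hausdorff_eps_argmin_tendsto[OF eps_tendsto _ _ R bounded_cball N0])
      show "\<exists>U. open U \<and> q \<in> U \<and> (\<forall>\<^sub>F n in sequentially. \<forall>p\<in>U. a \<le> empirical_cost c Ys n \<omega> p)"
        if "a < mean_cost P c Y q" for q a
        using elim(2) that by blast
      show "\<exists>p. \<forall>\<^sub>F n in sequentially. empirical_cost c Ys n \<omega> p < a" if less: "mean_cost P c Y q < a" for q a
      proof -
        obtain r where r: "mean_cost P c Y q < of_rat r" "of_rat r < a"
          using of_rat_dense[OF less] by blast
        have "mean_cost P c Y (D r) < of_rat r"
          unfolding D_def using r(1) by (rule someI)
        then have "mean_cost P c Y (D r) < a" using r(2) by linarith
        with elim(1) have "\<forall>\<^sub>F n in sequentially. empirical_cost c Ys n \<omega> (D r) < a"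
          by (intro order_tendstoD(2)) auto
        then show ?thesis by blast
      qed
    qed
  qed
qed

end
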